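(* Let $p\in[1,\infty)$, let $\mathbf X$ be a branched $p$-rough path on $[0,T]$ over $\mathbb{R}^d$ and $\mathbf Z$ an $\mathbf X$-controlled rough path with parameter $\gamma\ge[p]$, remainders $R^h$, $h\in\mathcal F^0_{[p]-1}$, and control $\omega_{\mathbf Z,\gamma}$. For $i\in\{1,\dots,d\}$ let $$\Xi^i_{s,t}:=\sum_{h\in\mathcal F^0_{[p]-1}}\mathbf Z^h_s\,\langle\mathbf X_{s,t},[h]_i\rangle.$$ Then $$\int_0^T\mathbf Z_s^\ell\,d\mathbf X^i_s:=\text{RRS-}\lim_{|\mathcal P|\to0}\sum_{(s,t)\in\mathcal P}\Xi^i_{s,t}$$ exists, and (the integral over $[s,t]$ being defined in the same way) $$\Big|\int_s^t\mathbf Z_r^\ell\,d\mathbf X^i_r-\Xi^i_{s,t}\Big|\le C\sum_{h\in\mathcal F^0_{[p]-1}}\|R^h\|_{\frac p{\gamma-|h|},[s,t)}\,\|\mathbf X^{[h]_i}\|_{\frac p{|h|+1},(s,t]},$$ with $C$ depending on $\gamma$ and $p$. In particular, if $\omega_{\mathbf X,p}(s+,t)=\omega_{\mathbf X,p}(s,t)$ for all $s<t$, or $\omega_{\mathbf Z,\gamma}(s,t-)=\omega_{\mathbf Z,\gamma}(s,t)$ for all $s<t$, the convergence holds in the MRS sense.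
   Context: Variation. For functions of two times $s\le t$, $p>0$ and an interval $I$, $\|\Xi\|_{p,I}=(\sup\sum|\Xi_{u,v}|^p)^{1/p}$, sup over finite partitions of $I$ into intervals with endpoints $u<v$ in $I$ (for half-open intervals, over partitions of compact subintervals). Trees and forests. Trees are non-planar rooted trees with at least one vertex, vertices labelled by $\{1,\dots,d\}$; a forest is a non-empty commutative product of trees, $\mathcal F$ the set of forests, $\mathbf 1$ the empty forest, $\mathcal H$ the real algebra with basis $\{\mathbf 1\}\cup\mathcal F$. $|f|$ is the number of vertices ($|\mathbf 1|=0$), $\mathcal F_n=\{f\in\mathcal F:|f|\le n\}$, $\mathcal F_n^0=\mathcal F_n\cup\{\mathbf 1\}$, $\mathcal H_n=\mathrm{span}\,\mathcal F_n^0$. $[\tau_1\cdots\tau_n]_i$ is the tree obtained by attaching $\tau_1,\dots,\tau_n$ to a new root labelled $i$; $[\mathbf 1]_i=\bullet_i$. The coproduct $\Delta:\mathcal H\to\mathcal H\otimes\mathcal H$ is the algebra morphism with $\Delta\mathbf 1=\mathbf 1\otimes\mathbf 1$ and $\Delta[\tau_1\cdots\tau_n]_i=[\tau_1\cdots\tau_n]_i\otimes\mathbf 1+\sum(\tau_1^{(1)}\cdots\tau_n^{(1)})\otimes[\tau_1^{(2)}\cdots\tau_n^{(2)}]_i$ (Sweedler notation). For linear functionals, $\langle l_1\star l_2,f\rangle=\langle l_1\otimes l_2,\Delta f\rangle$; $f^*$ is the dual basis element of $f$. The characters (algebra morphisms $\mathcal H\to\mathbb{R}$) form a group under $\star$;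 $G_N(\mathcal H^* )$ is the group of their restrictions to $\mathcal H_N$. A branched $p$-rough path is $\mathbf X:[0,T]\to G_{[p]}(\mathcal H^* )$ such that, with $\mathbf X_{s,t}=\mathbf X_s^{-1}\star\mathbf X_t$ and $\mathbf X^f_{s,t}=\langle\mathbf X_{s,t},f\rangle$, $\|\mathbf X^f\|_{p/|f|,[0,T]}<\infty$ for all $f\in\mathcal F_{[p]}$; $\omega_{\mathbf X,p}(s,t)=\sum_{f\in\mathcal F_{[p]}}\|\mathbf X^f\|_{p/|f|,[s,t]}^{p/|f|}$. A control is a function $\omega:\{0\le s\le t\le T\}\to[0,\infty)$ with $\omega(s,s)=0$ and $\omega(s,u)+\omega(u,t)\le\omega(s,t)$; $\omega(s+,t)=\lim_{u\downarrow s}\omega(u,t)$, $\omega(s,t-)=\lim_{u\uparrow t}\omega(s,u)$. $\mathbf Z:[0,T]\to\mathcal H_{[p]-1}$ with components $\mathbf Z^f=\langle f^*,\mathbf Z\rangle$ is an $\mathbf X$-controlled rough path (with parameter $\gamma\ge[p]$) if for all $f\in\mathcal F^0_{[p]-1}$, $\mathbf Z^f_t=\sum_{h\in\mathcal F^0_{[p]-1}}\mathbf Z^h_s\langle\mathbf X_{s,t}\star f^*,h\rangle+R^f_{s,t}$, where for some control $\omega_{\mathbf Z,\gamma}$, $\sum_{f\in\mathcal F^0_{[p]-1}}\|R^f\|_{p/(\gamma-|f|),[s,t]}^{p/(\gamma-|f|)}\le\omega_{\mathbf Z,\gamma}(s,t)$ for all $s\le t$. Riemann sums $\sum_{(u,v)\in\mathcal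 P}\Xi_{u,v}$ converge to $K$ in the RRS sense if for every $\varepsilon>0$ there is a partition $\mathcal P_\varepsilon$ such that $|\sum_{\mathcal P}\Xi_{u,v}-K|<\varepsilon$ for every refinement $\mathcal P\supset\mathcal P_\varepsilon$; in the MRS sense if for every $\varepsilon>0$ there is $\delta>0$ such that this holds for every $\mathcal P$ with mesh $|\mathcal P|<\delta$. *)

theory Defs
  imports "HOL-Analysis.Analysis" "HOL-Algebra.Group" "HOL-Library.Poly_Mapping"
    "HOL-Library.Product_Plus" "HOL-Library.Multiset"
begin

section \<open>Partitions, variation, controls\<close>

text \<open>A partition of \<open>[a, b]\<close> is the finite set of its nodes.  Refinement is then \<open>\<supseteq>\<close>, and the
  intervals of the partition are the pairs of consecutive nodes.\<close>

definition partitions :: "real \<Rightarrow> real \<Rightarrow> real set set" where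
  "partitions a b = {D. finite D \<and> a \<in> D \<and> b \<in> D \<and> D \<subseteq> {a..b}}"

definition cells :: "real set \<Rightarrow> (real \<times> real) set" where
  "cells D = {(u, v). u \<in> D \<and> v \<in> D \<and> u < v \<and> D \<inter> {u<..<v} = {}}"

definition mesh :: "real set \<Rightarrow> real" where
  "mesh D = Max (insert 0 ((\<lambda>(u, v). v - u) ` cells D))"

definition riemann_sum :: "(real \<Rightarrow> real \<Rightarrow> real) \<Rightarrow> real set \<Rightarrow> real" where
  "riemann_sum \<Xi> D = (\<Sum>(u, v)\<in>cells D. \<Xi> u v)"

definition RRS_limit :: "(real \<Rightarrow> real \<Rightarrow> real) \<Rightarrow> real \<Rightarrow> real \<Rightarrow> real \<Rightarrow> bool" where
  "RRS_limit \<Xi> a b K \<longleftrightarrow>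
     (\<forall>\<epsilon>>0. \<exists>D0\<in>partitions a b. \<forall>D\<in>partitions a b. D0 \<subseteq> D \<longrightarrow> \<bar>riemann_sum \<Xi> D - K\<bar> < \<epsilon>)"

definition MRS_limit :: "(real \<Rightarrow> real \<Rightarrow> real) \<Rightarrow> real \<Rightarrow> real \<Rightarrow> real \<Rightarrow> bool" where
  "MRS_limit \<Xi> a b K \<longleftrightarrow>
     (\<forall>\<epsilon>>0. \<exists>\<delta>>0. \<forall>D\<in>partitions a b. mesh D < \<delta> \<longrightarrow> \<bar>riemann_sum \<Xi> D - K\<bar> < \<epsilon>)"

definition ennpowr :: "ennreal \<Rightarrow> real \<Rightarrow> ennreal" where
  "ennpowr x a = (if x = \<infinity> then \<infinity> else ennreal (enn2real x powr a))"

text \<open>The \<open>q\<close>-variation norm over an interval \<open>I\<close>, with values in \<open>[0, \<infinity>]\<close> (and \<open>0\<close> if \<open>I\<close> is empty).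
  The supremum is over the partitions of the compact subintervals of \<open>I\<close>.  If \<open>I\<close> is itself
  compact, this is the supremum over the partitions of \<open>I\<close>, since adjoining the endpoints of \<open>I\<close>
  to the nodes only adds non-negative terms.\<close>

definition pvar :: "real \<Rightarrow> (real \<Rightarrow> real \<Rightarrow> real) \<Rightarrow> real set \<Rightarrow> ennreal" where
  "pvar q \<Xi> I =
     ennpowr (SUP D\<in>\<Union>{partitions a b | a b. a \<le> b \<and> {a..b} \<subseteq> I}.
                ennreal (\<Sum>(u, v)\<in>cells D. \<bar>\<Xi> u v\<bar> powr q)) (1 / q)"

text \<open>Controls are functions of \<open>0 \<le> s \<le> t \<le> T\<close>; values elsewhere are irrelevant.\<close>

definition is_control :: "real \<Rightarrow> (real \<Rightarrow> real \<Rightarrow> real) \<Rightarrow> bool" where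
  "is_control T \<omega> \<longleftrightarrow>
     (\<forall>s t. 0 \<le> s \<and> s \<le> t \<and> t \<le> T \<longrightarrow> 0 \<le> \<omega> s t) \<and>
     (\<forall>s. 0 \<le> s \<and> s \<le> T \<longrightarrow> \<omega> s s = 0) \<and>
     (\<forall>s u t. 0 \<le> s \<and> s \<le> u \<and> u \<le> t \<and> t \<le> T \<longrightarrow> \<omega> s u + \<omega> u t \<le> \<omega> s t)"


section \<open>The Connes--Kreimer Hopf algebra\<close>

text \<open>The label set \<open>{1, \<dots>, d}\<close> is a type \<open>'d\<close>, to be taken finite, with \<open>CARD('d) = d\<close>.\<close>

datatype 'd tree = Node 'd "'d tree multiset"

text \<open>The empty multiset is the empty forest, and the product of forests is \<open>+\<close> of multisets.\<close>

type_synonym 'd forest = "'d tree multiset"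

primrec tree_size :: "'d tree \<Rightarrow> nat" where
  "tree_size (Node i f) = Suc (sum_mset (image_mset tree_size f))"

definition forest_size :: "'d forest \<Rightarrow> nat" where
  "forest_size f = sum_mset (image_mset tree_size f)"

definition forests0 :: "nat \<Rightarrow> 'd forest set" where
  "forests0 n = {f. forest_size f \<le> n}"

definition forests :: "nat \<Rightarrow> 'd forest set" where
  "forests n = forests0 n - {{#}}"

abbreviation graft :: "'d \<Rightarrow> 'd forest \<Rightarrow> 'd forest" where
  "graft i f \<equiv> {#Node i f#}"

text \<open>\<open>'d forest \<Rightarrow>\<^sub>0 real\<close> is the monoid algebra of the commutative monoid of forests, i.e. \<open>\<H>\<close>;
  in the same way, \<open>'d forest \<times> 'd forest \<Rightarrow>\<^sub>0 real\<close> is the algebra \<open>\<H> \<otimes> \<H>\<close>.\<close>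

type_synonym 'd ck = "'d forest \<Rightarrow>\<^sub>0 real"
type_synonym 'd ck2 = "'d forest \<times> 'd forest \<Rightarrow>\<^sub>0 real"

definition ck_upto :: "nat \<Rightarrow> 'd ck set" where
  "ck_upto n = {x. Poly_Mapping.keys x \<subseteq> forests0 n}"

text \<open>The linear map \<open>\<H> \<otimes> \<H> \<rightarrow> \<H> \<otimes> \<H>\<close> with \<open>f \<otimes> g \<mapsto> f \<otimes> [g]\<^sub>i\<close> on the basis.\<close>

definition graft_right :: "'d \<Rightarrow> 'd ck2 \<Rightarrow> 'd ck2" where
  "graft_right i x =
     (\<Sum>(f, g)\<in>Poly_Mapping.keys x.
        Poly_Mapping.single (f, graft i g) (Poly_Mapping.lookup x (f, g)))"

primrec tree_coproduct :: "'d tree \<Rightarrow> 'd ck2" where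
  "tree_coproduct (Node i f) =
     Poly_Mapping.single (graft i f, {#}) 1
       + graft_right i (prod_mset (image_mset tree_coproduct f))"

text \<open>The coproduct on the basis of forests: the multiplicative extension from trees.\<close>

definition coproduct :: "'d forest \<Rightarrow> 'd ck2" where
  "coproduct f = prod_mset (image_mset tree_coproduct f)"

text \<open>A linear functional on \<open>\<H>\<close> is identified with its values on the basis of forests; linear
  functionals on \<open>\<H>\<^sub>N\<close> are those which vanish at the forests with more than \<open>N\<close> vertices.\<close>

type_synonym 'd ck_dual = "'d forest \<Rightarrow> real"

definition dual_basis :: "'d forest \<Rightarrow> 'd ck_dual" where
  "dual_basis f = (\<lambda>h. if h = f then 1 else 0)"

definition convolution :: "'d ck_dual \<Rightarrow> 'd ck_dual \<Rightarrow> 'd ck_dual" (infixl \<open>\<star>\<close> 70) where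
  "l1 \<star> l2 = (\<lambda>f. \<Sum>(a, b)\<in>Poly_Mapping.keys (coproduct f).
                     Poly_Mapping.lookup (coproduct f) (a, b) * (l1 a * l2 b))"

definition truncation :: "nat \<Rightarrow> 'd ck_dual \<Rightarrow> 'd ck_dual" where
  "truncation N l = (\<lambda>f. if f \<in> forests0 N then l f else 0)"

definition is_character :: "'d ck_dual \<Rightarrow> bool" where
  "is_character l \<longleftrightarrow> l {#} = 1 \<and> (\<forall>f g. l (f + g) = l f * l g)"

text \<open>The group \<open>G\<^sub>N(\<H>\<^sup>*)\<close> of restrictions to \<open>\<H>\<^sub>N\<close> of characters.  Its unit is the counit \<open>\<one>\<^sup>*\<close>.
  The values of \<open>l1 \<star> l2\<close> on \<open>\<H>\<^sub>N\<close> only involve those of \<open>l1\<close> and \<open>l2\<close> on \<open>\<H>\<^sub>N\<close>.\<close>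

definition butcher_group :: "nat \<Rightarrow> 'd ck_dual monoid" where
  "butcher_group N =
     \<lparr>carrier = truncation N ` {l. is_character l},
      monoid.mult = (\<lambda>l1 l2. truncation N (l1 \<star> l2)),
      one = dual_basis {#}\<rparr>"


section \<open>Branched rough paths and controlled rough paths\<close>

definition level :: "real \<Rightarrow> nat" where
  "level p = nat \<lfloor>p\<rfloor>"

definition increment :: "real \<Rightarrow> (real \<Rightarrow> 'd ck_dual) \<Rightarrow> real \<Rightarrow> real \<Rightarrow> 'd ck_dual" where
  "increment p X s t =
     inv\<^bsub>butcher_group (level p)\<^esub> (X s) \<otimes>\<^bsub>butcher_group (level p)\<^esub> X t"

definition branched_rough_path :: "real \<Rightarrow> real \<Rightarrow> (real \<Rightarrow> 'd ck_dual) \<Rightarrow> bool" where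
  "branched_rough_path p T X \<longleftrightarrow>
     (\<forall>t\<in>{0..T}. X t \<in> carrier (butcher_group (level p))) \<and>
     (\<forall>f\<in>forests (level p).
        pvar (p / forest_size f) (\<lambda>s t. increment p X s t f) {0..T} < \<infinity>)"

definition rough_control :: "real \<Rightarrow> (real \<Rightarrow> 'd ck_dual) \<Rightarrow> real \<Rightarrow> real \<Rightarrow> ennreal" where
  "rough_control p X s t =
     (\<Sum>f\<in>forests (level p).
        ennpowr (pvar (p / forest_size f) (\<lambda>u v. increment p X u v f) {s..t})
                (p / forest_size f))"

text \<open>The component \<open>\<langle>f\<^sup>*, Z t\<rangle>\<close> is \<open>Poly_Mapping.lookup (Z t) f\<close>.  The remainders are determined by
  \<open>X\<close> and \<open>Z\<close>.\<close>

definition remainder ::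
  "real \<Rightarrow> (real \<Rightarrow> 'd ck_dual) \<Rightarrow> (real \<Rightarrow> 'd ck) \<Rightarrow> 'd forest \<Rightarrow> real \<Rightarrow> real \<Rightarrow> real" where
  "remainder p X Z f s t =
     Poly_Mapping.lookup (Z t) f
       - (\<Sum>h\<in>forests0 (level p - 1).
            Poly_Mapping.lookup (Z s) h * (increment p X s t \<star> dual_basis f) h)"

definition controlled_rough_path ::
  "real \<Rightarrow> real \<Rightarrow> real \<Rightarrow> (real \<Rightarrow> 'd ck_dual) \<Rightarrow> (real \<Rightarrow> 'd ck) \<Rightarrow> (real \<Rightarrow> real \<Rightarrow> real) \<Rightarrow> bool"
where
  "controlled_rough_path p \<gamma> T X Z \<omega> \<longleftrightarrow>
     (\<forall>t\<in>{0..T}. Z t \<in> ck_upto (level p - 1)) \<and>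
     is_control T \<omega> \<and>
     (\<forall>s t. 0 \<le> s \<and> s \<le> t \<and> t \<le> T \<longrightarrow>
        (\<Sum>f\<in>forests0 (level p - 1).
           ennpowr (pvar (p / (\<gamma> - forest_size f)) (remainder p X Z f) {s..t})
                   (p / (\<gamma> - forest_size f))) \<le> ennreal (\<omega> s t))"

definition germ ::
  "real \<Rightarrow> (real \<Rightarrow> 'd ck_dual) \<Rightarrow> (real \<Rightarrow> 'd ck) \<Rightarrow> 'd \<Rightarrow> real \<Rightarrow> real \<Rightarrow> real" where
  "germ p X Z i s t =
     (\<Sum>h\<in>forests0 (level p - 1).
        Poly_Mapping.lookup (Z s) h * increment p X s t (graft i h))"

text \<open>The RRS limit is unique if it exists.\<close>

definition rough_integral ::
  "real \<Rightarrow> (real \<Rightarrow> 'd ck_dual) \<Rightarrow> (real \<Rightarrow> 'd ck) \<Rightarrow> 'd \<Rightarrow> real \<Rightarrow> real \<Rightarrow> real" where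
  "rough_integral p X Z i s t = (THE K. RRS_limit (germ p X Z i) s t K)"

end

theory Submission
  imports Defs
begin

text \<open>The germ \<open>\<Xi>\<close> of the rough integral is not additive, but its defect has a special form.  Chen's
  relation and the definition of a controlled path give (\<open>germ_chen\<close>)
  \<open>\<Xi>\<^sub>s\<^sub>,\<^sub>t = \<Xi>\<^sub>s\<^sub>,\<^sub>u + \<Xi>\<^sub>u\<^sub>,\<^sub>t - (\<Sum>h. R\<^sup>h\<^sub>s\<^sub>,\<^sub>u X\<^sup>[\<^sup>h\<^sup>]\<^sub>u\<^sub>,\<^sub>t)\<close>,
  a sum of products of a function with finite \<open>p / (\<gamma> - |h|)\<close>-variation and one with finite
  \<open>p / (|h| + 1)\<close>-variation.  The reciprocal exponents add up to \<open>\<theta> = (\<gamma> + 1) / p > 1\<close>, which is the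
  situation of Young integration.

  Chen's relation rests on the algebra of characters of the Connes--Kreimer algebra: they form
  a group under convolution (\<open>group_butcher_group\<close>).  Contracting the coproduct with a character
  gives an algebra endomorphism, so that associativity (\<open>act_convolution\<close>) and the existence of
  inverses (\<open>left_inverse_character\<close>) need to be verified on trees only, where the recursive
  definition of the coproduct does the work.

  The estimate is Young's argument.  From a partition with \<open>n\<close> interior nodes one can remove a node
  at a cost of order \<open>n powr - \<theta>\<close> (\<open>one_point_removal\<close>); these costs are summable, so all Riemann sums
  over \<open>[s, t]\<close> stay within a constant multiple of
  \<open>\<Sum>h. \<parallel>R\<^sup>h\<parallel> \<parallel>X\<^sup>[\<^sup>h\<^sup>]\<parallel>\<close> of \<open>\<Xi>\<^sub>s\<^sub>,\<^sub>t\<close> (\<open>young_maximal_bound\<close>).  Interior nodes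
  see \<open>R\<close> only on cells that avoid \<open>t\<close> and \<open>X\<close> only on cells that avoid \<open>s\<close>, so the norms may be taken over
  \<open>[s, t)\<close> and \<open>(s, t]\<close>.

  For convergence this bound is applied inside the cells of a partition, and the half-open
  intervals become decisive: near any point, the variation over \<open>(x, v]\<close> tends to zero as \<open>v \<down> x\<close>
  and the one over \<open>[u, x)\<close> as \<open>u \<up> x\<close>, whatever the jumps at \<open>x\<close>.  By compactness there are partitions on
  all of whose cells one of the two factors is small (\<open>good_partition\<close>), and since \<open>\<theta> > 1\<close> the sum of
  the bounds over the cells is then small; this gives the limit under refinement (\<open>sewing_exists\<close>).

  For a partition of small mesh, one adds the finitely many nodes of a good partition.  Each of
  them changes the sum by the defect at a fixed point \<open>x\<close>, which tends to zero if either \<open>X\<close> has no jump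
  to the right of \<open>x\<close> or \<open>R\<close> has none to the left (\<open>MRS_limit_if_RRS_limit\<close>).\<close>

section \<open>Linear maps on a monoid algebra\<close>

lemma poly_mapping_as_sum:
  fixes x :: "'k \<Rightarrow>\<^sub>0 'b::comm_monoid_add"
  shows "x = (\<Sum>k\<in>Poly_Mapping.keys x. Poly_Mapping.single k (Poly_Mapping.lookup x k))"
proof (rule poly_mapping_eqI)
  fix k
  show "Poly_Mapping.lookup x k = Poly_Mapping.lookup
      (\<Sum>k\<in>Poly_Mapping.keys x. Poly_Mapping.single k (Poly_Mapping.lookup x k)) k"
    by (cases "k \<in> Poly_Mapping.keys x")
      (auto simp: lookup_sum lookup_single when_def in_keys_iff)
qed

text \<open>Additive maps on a monoid algebra are determined by the monomials; this is the induction
  behind all identities between linear maps below.\<close>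

lemma poly_mapping_additive_induct [case_names single add]:
  fixes x :: "'k \<Rightarrow>\<^sub>0 'b::comm_monoid_add"
  assumes "\<And>k c. P (Poly_Mapping.single k c)"
    and "\<And>x y. P x \<Longrightarrow> P y \<Longrightarrow> P (x + y)"
  shows "P x"
proof -
  have "P (\<Sum>k\<in>A. Poly_Mapping.single k (Poly_Mapping.lookup x k))" if "finite A" for A
    using that
  proof (induction A rule: finite_induct)
    case empty
    show ?case using assms(1)[of undefined 0] by simp
  qed (simp add: assms)
  from this[OF finite_keys] show ?thesis
    by (subst poly_mapping_as_sum)
qed

text \<open>The linear maps needed below go from \<open>\<H>\<close> or \<open>\<H> \<otimes> \<H>\<close> to \<open>\<real>\<close> or to \<open>\<H>\<close>. The embedding \<open>e\<close> of
  the scalars into the target algebra makes both kinds instances of one construction.\<close>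

locale scalar_embedding =
  fixes e :: "real \<Rightarrow> 'r::comm_ring_1"
  assumes e_add: "e (a + b) = e a + e b" and e_mult: "e (a * b) = e a * e b"
begin

lemma e_0: "e 0 = 0"
  using e_add[of 0 0] by simp

definition linear_ext :: "('k \<Rightarrow> 'r) \<Rightarrow> ('k \<Rightarrow>\<^sub>0 real) \<Rightarrow> 'r" where
  "linear_ext \<phi> x = (\<Sum>k\<in>Poly_Mapping.keys x. e (Poly_Mapping.lookup x k) * \<phi> k)"

lemma linear_ext_0 [simp]: "linear_ext \<phi> 0 = 0"
  by (simp add: linear_ext_def)

lemma linear_ext_single [simp]: "linear_ext \<phi> (Poly_Mapping.single k c) = e c * \<phi> k"
  by (simp add: linear_ext_def e_0)

lemma linear_ext_add [simp]: "linear_ext \<phi> (x + y) = linear_ext \<phi> x + linear_ext \<phi> y"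
  unfolding linear_ext_def
  by (rule setsum_keys_plus_distrib) (simp_all add: e_0 e_add distrib_right)

lemma linear_ext_diff [simp]: "linear_ext \<phi> (x - y) = linear_ext \<phi> x - linear_ext \<phi> y"
  using linear_ext_add[of \<phi> "x - y" y] by (simp add: algebra_simps)

text \<open>The universal property of a monoid algebra: a multiplicative map on the basis extends to a
  multiplicative map. For a character \<open>l\<close> it applies to \<open>l\<close> itself and to the contraction
  \<open>l \<otimes> id\<close>.\<close>

lemma linear_ext_mult:
  fixes \<phi> :: "'k::comm_monoid_add \<Rightarrow> 'r"
  assumes "\<And>k l. \<phi> (k + l) = \<phi> k * \<phi> l"
  shows "linear_ext \<phi> (x * y) = linear_ext \<phi> x * linear_ext \<phi> y"
proof (induction x rule: poly_mapping_additive_induct)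
  case (single k c)
  show ?case
    by (induction y rule: poly_mapping_additive_induct)
      (simp_all add: mult_single e_mult assms algebra_simps)
qed (simp add: algebra_simps)

end

interpretation real_ext: scalar_embedding "\<lambda>c. c :: real"
  by standard auto

interpretation alg_ext:
  scalar_embedding "Poly_Mapping.single 0 :: real \<Rightarrow> ('k::comm_monoid_add \<Rightarrow>\<^sub>0 real)"
  by standard (auto simp: single_add mult_single)

section \<open>Characters of the Connes--Kreimer algebra\<close>

definition ev :: "'d ck_dual \<Rightarrow> 'd ck \<Rightarrow> real" where
  "ev = real_ext.linear_ext"

definition graft_lin :: "'d \<Rightarrow> 'd ck \<Rightarrow> 'd ck" where
  "graft_lin i = alg_ext.linear_ext (\<lambda>g. Poly_Mapping.single (graft i g) 1)"

text \<open>The contraction \<open>l \<otimes> id\<close>.\<close>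

definition contract_left :: "'d ck_dual \<Rightarrow> 'd ck2 \<Rightarrow> 'd ck" where
  "contract_left l = alg_ext.linear_ext (\<lambda>(a, b). Poly_Mapping.single b (l a))"

text \<open>\<open>act l f = (l \<otimes> id)(\<Delta> f)\<close>. The convolution \<open>l \<star> m\<close> is the composition of \<open>m\<close> with this map,
  and for a character \<open>l\<close> the map is multiplicative. Coassociativity and inverses can therefore be
  treated as statements about endomorphisms of the algebra \<open>\<H>\<close>, checked on trees only.\<close>

definition act :: "'d ck_dual \<Rightarrow> 'd forest \<Rightarrow> 'd ck" where
  "act l f = contract_left l (coproduct f)"

definition act_lin :: "'d ck_dual \<Rightarrow> 'd ck \<Rightarrow> 'd ck" where
  "act_lin l = alg_ext.linear_ext (act l)"

lemma ev_simps [simp]: "ev m 0 = 0" "ev m (x + y) = ev m x + ev m y"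
  "ev m (x - y) = ev m x - ev m y" "ev m (Poly_Mapping.single k c) = c * m k"
  by (simp_all add: ev_def)

lemma graft_lin_simps [simp]: "graft_lin i (x + y) = graft_lin i x + graft_lin i y"
  "graft_lin i (Poly_Mapping.single k c) = Poly_Mapping.single (graft i k) c"
  by (simp_all add: graft_lin_def mult_single)

lemma contract_left_simps [simp]:
  "contract_left l (x + y) = contract_left l x + contract_left l y"
  "contract_left l (Poly_Mapping.single (a, b) c) = Poly_Mapping.single b (c * l a)"
  by (simp_all add: contract_left_def mult_single)

lemma act_lin_simps [simp]: "act_lin l (x + y) = act_lin l x + act_lin l y"
  "act_lin l (Poly_Mapping.single k c) = Poly_Mapping.single {#} c * act l k"
  by (simp_all add: act_lin_def)

lemma graft_right_eq:
  "graft_right i =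
     alg_ext.linear_ext (\<lambda>(f, g). Poly_Mapping.single (f, graft i g) 1)"
  unfolding graft_right_def alg_ext.linear_ext_def fun_eq_iff
  by (auto intro!: sum.cong simp: mult_single)

lemma coproduct_empty [simp]: "coproduct {#} = 1"
  by (simp add: coproduct_def)

lemma coproduct_add: "coproduct (f + g) = coproduct f * coproduct g"
  by (simp add: coproduct_def)

lemma coproduct_graft:
  "coproduct (graft i f) = Poly_Mapping.single (graft i f, {#}) 1 + graft_right i (coproduct f)"
  by (simp add: coproduct_def)

lemma contract_left_graft_right:
  "contract_left l (graft_right i x) = graft_lin i (contract_left l x)"
proof (induction x rule: poly_mapping_additive_induct)
  case (single k c)
  show ?case
    by (cases k) (simp add: graft_right_eq mult_single)
qed (simp add: graft_right_eq)

text \<open>The recursion that defines the coproduct, contracted with \<open>l\<close>.\<close>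

lemma act_graft:
  "act l (graft i f) = Poly_Mapping.single {#} (l (graft i f)) + graft_lin i (act l f)"
  by (simp add: act_def coproduct_graft contract_left_graft_right)

lemma act_empty: "is_character l \<Longrightarrow> act l {#} = 1"
  unfolding act_def coproduct_empty
  by (metis contract_left_simps(2) is_character_def mult_1 single_one zero_prod_def)

lemma act_add:
  assumes "is_character l"
  shows "act l (f + g) = act l f * act l g"
  unfolding act_def contract_left_def coproduct_add
  by (rule alg_ext.linear_ext_mult)
    (use assms in \<open>auto simp: mult_single is_character_def\<close>)

lemma ev_mult:
  assumes "is_character l"
  shows "ev l (x * y) = ev l x * ev l y"
  unfolding ev_def by (rule real_ext.linear_ext_mult) (use assms in \<open>auto simp: is_character_def\<close>)

lemma ev_act: "ev m (act l f) = (l \<star> m) f"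
proof -
  have "ev m (contract_left l x) = real_ext.linear_ext (\<lambda>(a, b). l a * m b) x" for x
  proof (induction x rule: poly_mapping_additive_induct)
    case (single k c)
    show ?case by (cases k) simp
  qed simp
  then show ?thesis
    by (simp add: act_def convolution_def real_ext.linear_ext_def case_prod_unfold)
qed

lemma ev_1: "is_character l \<Longrightarrow> ev l 1 = 1"
  by (metis ev_simps(4) is_character_def mult_1 single_one)

lemma convolution_character:
  assumes "is_character l" "is_character m"
  shows "is_character (l \<star> m)"
  using assms
  by (simp add: is_character_def[of "l \<star> m"] flip: ev_act) (simp add: act_empty act_add ev_mult ev_1)

text \<open>The nested induction over trees and multisets of trees in one rule: a property which
  grafting and products preserve holds for every forest.\<close>

lemma forest_induct [case_names empty graft add]:
  fixes f :: "'d forest"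
  assumes "P {#}" "\<And>i f. P f \<Longrightarrow> P (graft i f)" "\<And>f g. P f \<Longrightarrow> P g \<Longrightarrow> P (f + g)"
  shows "P f"
proof -
  have *: "P f" if "\<And>\<tau>. \<tau> \<in># f \<Longrightarrow> P {#\<tau>#}" for f
    using that
  proof (induction f)
    case (add \<tau> f)
    then have "P ({#\<tau>#} + f)" by (intro assms(3)) auto
    then show ?case by simp
  qed (rule assms(1))
  have "P {#\<tau>#}" for \<tau>
    by (induction \<tau>) (auto intro: assms(2) *)
  then show ?thesis by (rule *)
qed

lemma convolution_graft:
  "(l \<star> m) (graft i f) = l (graft i f) * m {#} + ev m (graft_lin i (act l f))"
  by (simp flip: ev_act add: act_graft)

lemma act_lin_graft_lin:
  "act_lin l (graft_lin i x) = Poly_Mapping.single {#} (ev l (graft_lin i x)) + graft_lin i (act_lin l x)"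
proof (induction x rule: poly_mapping_additive_induct)
  case (single k c)
  have "graft_lin i (Poly_Mapping.single {#} c * x) = Poly_Mapping.single {#} c * graft_lin i x" for x
    by (induction x rule: poly_mapping_additive_induct) (simp_all add: mult_single algebra_simps)
  then show ?case
    by (simp add: act_graft distrib_left mult_single)
qed (simp add: single_add)

text \<open>Coassociativity of \<open>\<Delta>\<close>, contracted with two characters. Both sides are multiplicative in
  \<open>f\<close>, and both satisfy the same recursion under grafting: \<open>act_graft\<close> produces the scalar
  \<open>l [f]\<^sub>i + m (B\<^sub>i (act l f))\<close>, which is \<open>(l \<star> m) [f]\<^sub>i\<close>, plus a grafted term covered by the
  induction hypothesis.\<close>

lemma act_convolution:
  assumes "is_character l" "is_character m"
  shows "act (l \<star> m) f = act_lin m (act l f)"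
proof (induction f rule: forest_induct)
  case empty
  have "act_lin m 1 = 1"
    using act_lin_simps(2)[of m 0 1] act_empty[OF assms(2)]
    by (metis mult_1 single_one)
  then show ?case
    by (simp add: act_empty assms convolution_character)
next
  case (graft i f)
  have "m {#} = 1" using assms by (simp add: is_character_def)
  moreover have "act m {#} = 1" by (rule act_empty) fact
  ultimately show ?case using graft
    by (simp add: act_graft convolution_graft act_lin_graft_lin single_add)
next
  case (add f g)
  have "act_lin m (x * y) = act_lin m x * act_lin m y" for x y
    unfolding act_lin_def by (rule alg_ext.linear_ext_mult) (rule act_add[OF assms(2)])
  with add show ?case
    by (simp add: act_add assms convolution_character)
qed

text \<open>Pairing \<open>act_convolution\<close> with a third functional: the value \<open>(l \<star> m) f\<close> is the linear
  extension of \<open>m\<close>, evaluated at \<open>act l f\<close>.\<close>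

lemma convolution_assoc:
  assumes "is_character l" "is_character m"
  shows "l \<star> m \<star> k = l \<star> (m \<star> k)"
proof
  fix f
  have "ev k (act_lin m x) = ev (m \<star> k) x" for x
  proof (induction x rule: poly_mapping_additive_induct)
    case (single f c)
    have "ev k (Poly_Mapping.single {#} c * x) = c * ev k x" for x
      by (induction x rule: poly_mapping_additive_induct) (simp_all add: mult_single algebra_simps)
    then show ?case by (simp add: ev_act)
  qed simp
  then show "(l \<star> m \<star> k) f = (l \<star> (m \<star> k)) f"
    by (simp add: act_convolution assms flip: ev_act)
qed

lemma counit_character: "is_character (dual_basis {#})"
  by (auto simp: is_character_def dual_basis_def)

lemma act_counit: "act (dual_basis {#}) f = Poly_Mapping.single f 1"
proof (induction f rule: forest_induct)
  case empty
  show ?case by (metis act_empty counit_character single_one)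
next
  case (graft i f)
  then show ?case by (simp add: act_graft) (simp add: dual_basis_def)
next
  case (add f g)
  then show ?case by (simp add: act_add counit_character mult_single)
qed

lemma counit_convolution: "dual_basis {#} \<star> l = l"
  by (rule ext) (simp add: act_counit flip: ev_act)

text \<open>If \<open>m \<star> l\<close> is the counit, then \<open>act_graft\<close> for \<open>m\<close> forces \<open>m [f]\<^sub>i = - l (B\<^sub>i (act m f))\<close>.
  Substituting this value back into \<open>act_graft\<close> turns it into a recursion for \<open>act m\<close> on trees
  that mentions only \<open>l\<close>, and this function is its solution.\<close>

primrec inverse_act :: "'d ck_dual \<Rightarrow> 'd tree \<Rightarrow> 'd ck" where
  "inverse_act l (Node i f) =
     (let x = graft_lin i (prod_mset (image_mset (inverse_act l) f))
      in x - Poly_Mapping.single {#} (ev l x))"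

primrec inverse_on_tree :: "'d ck_dual \<Rightarrow> 'd tree \<Rightarrow> real" where
  "inverse_on_tree l (Node i f) = - ev l (graft_lin i (prod_mset (image_mset (inverse_act l) f)))"

text \<open>The multiplicative extension of \<open>inverse_on_tree\<close> is a character by construction. Since
  \<open>m \<star> l\<close> is then a character too, it is enough to know that it vanishes on trees, and there the
  scalar subtracted in \<open>inverse_act\<close> cancels.\<close>

lemma left_inverse_character:
  assumes l: "is_character l"
  shows "\<exists>m. is_character m \<and> m \<star> l = dual_basis {#}"
proof -
  define m where "m f = prod_mset (image_mset (inverse_on_tree l) f)" for f
  have m: "is_character m"
    by (auto simp: is_character_def m_def)
  have act_m: "act m f = prod_mset (image_mset (inverse_act l) f)" for f
  proof (induction f rule: forest_induct)
    case (graft i f)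
    then show ?case by (simp add: act_graft) (simp add: m_def Let_def single_uminus)
  qed (simp_all add: act_empty act_add m)
  have "(m \<star> l) f = dual_basis {#} f" for f
  proof (induction f rule: forest_induct)
    case (graft i f)
    have "l {#} = 1" using l by (simp add: is_character_def)
    then have "(m \<star> l) (graft i f) = 0"
      by (simp flip: ev_act add: act_m Let_def)
    then show ?case by (simp add: dual_basis_def)
  next
    case empty
    then show ?case
      using convolution_character[OF m l] counit_character by (metis is_character_def)
  next
    case (add f g)
    then show ?case
      using convolution_character[OF m l] counit_character by (metis is_character_def)
  qed
  with m show ?thesis by blast
qed

section \<open>The Butcher group\<close>

lemma forest_size_simps [simp]: "forest_size {#} = 0" "forest_size (f + g) = forest_size f + forest_size g"
  "forest_size (graft i f) = Suc (forest_size f)"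
  by (simp_all add: forest_size_def)

text \<open>The coproduct cuts a forest in two and keeps the number of vertices. Hence \<open>l \<star> m\<close> on \<open>\<H>\<^sub>N\<close>
  involves only the values of \<open>l\<close> and \<open>m\<close> on \<open>\<H>\<^sub>N\<close>.\<close>

lemma coproduct_graded:
  "(a, b) \<in> Poly_Mapping.keys (coproduct f) \<Longrightarrow> forest_size a + forest_size b = forest_size f"
proof (induction f arbitrary: a b rule: forest_induct)
  case empty
  then show ?case by (simp add: zero_prod_def)
next
  case (graft i f)
  have "Poly_Mapping.keys (graft_right i x) \<subseteq> (\<lambda>(a, b). (a, graft i b)) ` Poly_Mapping.keys x" for x
    unfolding graft_right_def by (rule order_trans[OF Poly_Mapping.keys_sum]) (force split: if_splits)
  then have "Poly_Mapping.keys (coproduct (graft i f))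
      \<subseteq> insert (graft i f, {#}) ((\<lambda>(a, b). (a, graft i b)) ` Poly_Mapping.keys (coproduct f))"
    unfolding coproduct_graft
    using keys_add[of "Poly_Mapping.single (graft i f, {#}) (1::real)" "graft_right i (coproduct f)"]
    by force
  with graft.prems consider "(a, b) = (graft i f, {#})"
    | b' where "(a, b') \<in> Poly_Mapping.keys (coproduct f)" "b = graft i b'"
    by auto
  then show ?case
    by cases (use graft.IH in auto)
next
  case (add f g)
  from add.prems obtain a' b' a'' b'' where
    "(a', b') \<in> Poly_Mapping.keys (coproduct f)" "(a'', b'') \<in> Poly_Mapping.keys (coproduct g)"
    "(a, b) = (a', b') + (a'', b'')"
    using keys_mult[of "coproduct f" "coproduct g"] unfolding coproduct_add by auto
  with add.IH[of a' b'] add.IH[of a'' b''] show ?case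
    by auto
qed

lemma truncation_convolution:
  fixes l m :: "'a ck_dual"
  shows "truncation N (truncation N l \<star> truncation N m) = truncation N (l \<star> m)"
proof
  fix f :: "'a forest"
  show "truncation N (truncation N l \<star> truncation N m) f = truncation N (l \<star> m) f"
  proof (cases "forest_size f \<le> N")
    case True
    have "truncation N l a = l a \<and> truncation N m b = m b"
      if "(a, b) \<in> Poly_Mapping.keys (coproduct f)" for a b
      using coproduct_graded[OF that] True by (auto simp: truncation_def forests0_def)
    then have "(truncation N l \<star> truncation N m) f = (l \<star> m) f"
      unfolding convolution_def by (intro sum.cong) auto
    then show ?thesis by (simp add: truncation_def)
  qed (simp add: truncation_def forests0_def)
qed

lemma truncation_counit: "truncation N (dual_basis {#}) = dual_basis {#}"
  by (auto simp: truncation_def dual_basis_def forests0_def)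

text \<open>Truncation is compatible with \<open>\<star>\<close>, so the group axioms descend from the characters of \<open>\<H>\<close>.
  This is what gives \<open>inv\<close> its meaning in the increments of a rough path.\<close>

lemma group_butcher_group: "group (butcher_group N :: 'd ck_dual monoid)" (is "group ?G")
proof (rule groupI)
  have carrier: "truncation N l \<in> carrier ?G" if "is_character l" for l :: "'d ck_dual"
    using that by (simp add: butcher_group_def)
  have mult: "truncation N l \<otimes>\<^bsub>?G\<^esub> truncation N m = truncation N (l \<star> m)" for l m :: "'d ck_dual"
    by (simp add: butcher_group_def truncation_convolution)
  have one: "\<one>\<^bsub>?G\<^esub> = truncation N (dual_basis {#})"
    by (simp add: butcher_group_def truncation_counit)
  have ex: "\<exists>l. x = truncation N l \<and> is_character l" if "x \<in> carrier ?G" for x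
    using that by (auto simp: butcher_group_def)
  show "\<one>\<^bsub>?G\<^esub> \<in> carrier ?G"
    unfolding one by (rule carrier[OF counit_character])
  fix x assume "x \<in> carrier ?G"
  with ex obtain x' where x': "x = truncation N x'" "is_character x'" by blast
  show "\<one>\<^bsub>?G\<^esub> \<otimes>\<^bsub>?G\<^esub> x = x"
    unfolding one x' mult counit_convolution ..
  from left_inverse_character[OF x'(2)] obtain m where "is_character m" "m \<star> x' = dual_basis {#}"
    by blast
  then show "\<exists>y\<in>carrier ?G. y \<otimes>\<^bsub>?G\<^esub> x = \<one>\<^bsub>?G\<^esub>"
    by (intro bexI[of _ "truncation N m"] carrier) (simp_all add: x'(1) mult one)
  fix y assume "y \<in> carrier ?G"
  with ex obtain y' where y': "y = truncation N y'" "is_character y'" by blast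
  show "x \<otimes>\<^bsub>?G\<^esub> y \<in> carrier ?G"
    unfolding x' y' mult by (intro carrier convolution_character x' y')
  fix z assume "z \<in> carrier ?G"
  with ex obtain z' where z': "z = truncation N z'" "is_character z'" by blast
  show "x \<otimes>\<^bsub>?G\<^esub> y \<otimes>\<^bsub>?G\<^esub> z = x \<otimes>\<^bsub>?G\<^esub> (y \<otimes>\<^bsub>?G\<^esub> z)"
    unfolding x'(1) y'(1) z'(1) mult convolution_assoc[OF x'(2) y'(2)] ..
qed

lemma size_le_forest_size: "size f \<le> forest_size f"
proof (induction f)
  case (add \<tau> f)
  then show ?case by (cases \<tau>) (simp add: forest_size_def)
qed simp

text \<open>A forest with at most \<open>n + 1\<close> vertices has at most \<open>n + 1\<close> trees, each of them a root on top
  of a forest with at most \<open>n\<close> vertices.\<close>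

lemma finite_forests0: "finite (forests0 n :: 'd::finite forest set)"
proof (induction n)
  case 0
  have "f = {#}" if "forest_size f = 0" for f :: "'d forest"
    using size_le_forest_size[of f] that by simp
  then have "forests0 0 \<subseteq> {{#} :: 'd forest}"
    unfolding forests0_def by blast
  then show ?case
    by (rule finite_subset) simp
next
  case (Suc n)
  define A :: "'d tree set" where "A = (\<lambda>(i, f). Node i f) ` (UNIV \<times> forests0 n)"
  have "finite A" using Suc by (simp add: A_def)
  have A: "\<tau> \<in> A" if "\<tau> \<in># f" "forest_size f \<le> Suc n" for \<tau> and f :: "'d forest"
  proof -
    obtain g where f: "f = {#\<tau>#} + g"
      using \<open>\<tau> \<in># f\<close> by (metis insert_DiffM add_mset_add_single union_commute)
    obtain i h where \<tau>: "\<tau> = Node i h" by (cases \<tau>)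
    have "forest_size h \<le> n"
      using that(2) unfolding f \<tau> forest_size_simps by simp
    then show ?thesis by (auto simp: A_def \<tau> forests0_def)
  qed
  have "forests0 (Suc n) \<subseteq> mset ` {xs. set xs \<subseteq> A \<and> length xs \<le> Suc n}"
  proof (intro subsetI)
    fix f :: "'d forest" assume "f \<in> forests0 (Suc n)"
    then have f: "forest_size f \<le> Suc n" by (simp add: forests0_def)
    obtain xs where xs: "f = mset xs" by (metis ex_mset)
    have "set xs \<subseteq> A"
      using A[OF _ f] by (auto simp: xs)
    moreover have "length xs \<le> Suc n"
      using size_le_forest_size[of f] f unfolding xs by simp
    ultimately show "f \<in> mset ` {xs. set xs \<subseteq> A \<and> length xs \<le> Suc n}"
      using xs by blast
  qed
  then show ?case
    using finite_lists_length_le[OF \<open>finite A\<close>] by (meson finite_imageI finite_subset)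
qed

section \<open>The germ of the rough integral\<close>

text \<open>Chen's relation \<open>X\<^sub>s\<^sub>,\<^sub>t = X\<^sub>s\<^sub>,\<^sub>u \<star> X\<^sub>u\<^sub>,\<^sub>t\<close>, stated for characters that restrict to the
  truncated increments, so that the results on characters can be applied to them.\<close>

lemma increment_chen:
  assumes X: "\<forall>t\<in>{0..T}. X t \<in> carrier (butcher_group (level p))"
    and "s \<in> {0..T}" "u \<in> {0..T}" "t \<in> {0..T}"
  obtains x y where "is_character x" "is_character y"
    "increment p X s u = truncation (level p) x" "increment p X u t = truncation (level p) y"
    "increment p X s t = truncation (level p) (x \<star> y)"
proof -
  let ?G = "butcher_group (level p)"
  interpret group ?G by (rule group_butcher_group)
  have "increment p X s u \<in> carrier ?G" "increment p X u t \<in> carrier ?G"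
    using assms by (auto simp: increment_def)
  then obtain x y where xy: "is_character x" "is_character y"
    "increment p X s u = truncation (level p) x" "increment p X u t = truncation (level p) y"
    by (auto simp: butcher_group_def)
  have "increment p X s t = increment p X s u \<otimes>\<^bsub>?G\<^esub> increment p X u t"
    using assms by (simp add: increment_def m_assoc) (simp flip: m_assoc)
  also have "\<dots> = truncation (level p) (x \<star> y)"
    by (simp add: xy) (simp add: butcher_group_def truncation_convolution)
  finally show ?thesis using xy that by blast
qed

lemma increment_self:
  assumes "X t \<in> carrier (butcher_group (level p))"
  shows "increment p X t t = dual_basis {#}"
proof -
  interpret group "butcher_group (level p)" by (rule group_butcher_group)
  show ?thesis using assms by (simp add: increment_def) (simp add: butcher_group_def)
qed

lemma germ_self:
  assumes "X t \<in> carrier (butcher_group (level p))"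
  shows "germ p X Z i t t = 0"
  by (simp add: germ_def increment_self assms) (simp add: dual_basis_def)

lemma convolution_dual_basis: "(l \<star> dual_basis g) f = Poly_Mapping.lookup (act l f) g"
proof -
  have "ev (dual_basis g) x = Poly_Mapping.lookup x g" for x
    by (induction x rule: poly_mapping_additive_induct)
      (auto simp: dual_basis_def lookup_add lookup_single when_def)
  then show ?thesis by (simp flip: ev_act)
qed

lemma keys_act: "g \<in> Poly_Mapping.keys (act l f) \<Longrightarrow> forest_size g \<le> forest_size f"
proof -
  assume "g \<in> Poly_Mapping.keys (act l f)"
  moreover have "Poly_Mapping.keys (contract_left l x) \<subseteq> snd ` Poly_Mapping.keys x" for x
  proof -
    have "contract_left l x = (\<Sum>k\<in>Poly_Mapping.keys x. Poly_Mapping.single (snd k) (Poly_Mapping.lookup x k * l (fst k)))"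
      unfolding contract_left_def alg_ext.linear_ext_def
      by (auto intro!: sum.cong simp: mult_single)
    then show ?thesis
      by (simp, intro order_trans[OF Poly_Mapping.keys_sum]) (auto split: if_splits)
  qed
  ultimately show ?thesis
    unfolding act_def by (force dest: coproduct_graded)
qed

text \<open>The terms of \<open>\<Delta> [h]\<^sub>i\<close> are collected by their right factor \<open>[g]\<^sub>i\<close>. The coefficients that
  appear are those in the definition of a controlled path, \<open>\<langle>l \<star> g\<^sup>*, h\<rangle>\<close>.\<close>

lemma convolution_graft_expand:
  fixes l :: "'d::finite ck_dual"
  assumes "is_character m" "h \<in> forests0 n"
  shows "(l \<star> m) (graft i h) =
    l (graft i h) + (\<Sum>g\<in>forests0 n. (l \<star> dual_basis g) h * m (graft i g))"
proof -
  have "ev m (graft_lin i x) = real_ext.linear_ext (\<lambda>g. m (graft i g)) x" for x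
    by (induction x rule: poly_mapping_additive_induct) (simp_all)
  then have "ev m (graft_lin i (act l h)) =
      (\<Sum>g\<in>Poly_Mapping.keys (act l h). Poly_Mapping.lookup (act l h) g * m (graft i g))"
    by (simp add: real_ext.linear_ext_def)
  also have "\<dots> = (\<Sum>g\<in>forests0 n. Poly_Mapping.lookup (act l h) g * m (graft i g))"
    using assms(2) by (intro sum.mono_neutral_left finite_forests0)
      (auto simp: forests0_def in_keys_iff dest!: keys_act)
  finally show ?thesis
    using assms(1) by (simp add: convolution_graft convolution_dual_basis is_character_def)
qed

text \<open>By Chen's relation, the components of \<open>Z\<close> at \<open>s\<close> occur in \<open>\<Xi>\<^sub>s\<^sub>,\<^sub>t\<close> transported by
  \<open>X\<^sub>s\<^sub>,\<^sub>u\<close>; a controlled path equals its transport up to the remainder. What is left of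
  \<open>\<Xi>\<^sub>s\<^sub>,\<^sub>t - \<Xi>\<^sub>s\<^sub>,\<^sub>u - \<Xi>\<^sub>u\<^sub>,\<^sub>t\<close> is a sum of products of the Young type: one factor on \<open>[s, u]\<close>,
  the other on \<open>[u, t]\<close>.\<close>

lemma germ_chen:
  fixes X :: "real \<Rightarrow> 'd::finite ck_dual"
  assumes X: "\<forall>t\<in>{0..T}. X t \<in> carrier (butcher_group (level p))"
    and mem: "s \<in> {0..T}" "u \<in> {0..T}" "t \<in> {0..T}" and p: "1 \<le> p"
  shows "germ p X Z i s t = germ p X Z i s u + germ p X Z i u t
    - (\<Sum>h\<in>forests0 (level p - 1). remainder p X Z h s u * increment p X u t (graft i h))"
proof -
  let ?F = "forests0 (level p - 1)"
  let ?Z = "\<lambda>t. Poly_Mapping.lookup (Z t)"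
  obtain x y where xy: "is_character x" "is_character y"
    "increment p X s u = truncation (level p) x" "increment p X u t = truncation (level p) y"
    "increment p X s t = truncation (level p) (x \<star> y)"
    using increment_chen[OF X mem] by blast
  have "1 \<le> level p" using p by (simp add: level_def le_nat_iff)
  then have tr: "truncation (level p) l (graft i h) = l (graft i h)" if "h \<in> ?F" for l h
    using that by (auto simp: truncation_def forests0_def)
  have tr_conv: "(truncation (level p) x \<star> dual_basis g) h = (x \<star> dual_basis g) h" if "h \<in> ?F" for g h
    using that unfolding convolution_def
    by (intro sum.cong) (auto simp: truncation_def forests0_def dest: coproduct_graded)
  have rem: "remainder p X Z g s u = ?Z u g - (\<Sum>h\<in>?F. ?Z s h * (x \<star> dual_basis g) h)" for g :: "'d forest"
    unfolding remainder_def xy by (simp add: tr_conv)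
  have "germ p X Z i s t = (\<Sum>h\<in>?F. ?Z s h * (x (graft i h)
      + (\<Sum>g\<in>?F. (x \<star> dual_basis g) h * y (graft i g))))"
    unfolding germ_def xy
    by (intro sum.cong refl) (simp add: tr convolution_graft_expand[OF xy(2)])
  also have "\<dots> = (\<Sum>h\<in>?F. ?Z s h * x (graft i h))
      + (\<Sum>h\<in>?F. \<Sum>g\<in>?F. ?Z s h * (x \<star> dual_basis g) h * y (graft i g))"
    by (simp add: distrib_left sum.distrib sum_distrib_left mult.assoc)
  also have "(\<Sum>h\<in>?F. \<Sum>g\<in>?F. ?Z s h * (x \<star> dual_basis g) h * y (graft i g))
      = (\<Sum>g\<in>?F. (\<Sum>h\<in>?F. ?Z s h * (x \<star> dual_basis g) h) * y (graft i g))"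
    by (subst sum.swap) (simp add: sum_distrib_right)
  also have "\<dots> = (\<Sum>g\<in>?F. (?Z u g - remainder p X Z g s u) * y (graft i g))"
    by (simp add: rem)
  also have "(\<Sum>h\<in>?F. ?Z s h * x (graft i h)) = germ p X Z i s u"
    unfolding germ_def xy by (intro sum.cong refl) (simp add: tr)
  also have "(\<Sum>g\<in>?F. (?Z u g - remainder p X Z g s u) * y (graft i g))
      = germ p X Z i u t - (\<Sum>h\<in>?F. remainder p X Z h s u * increment p X u t (graft i h))"
    unfolding germ_def xy by (simp add: tr left_diff_distrib sum_subtractf)
  finally show ?thesis by simp
qed


section \<open>Partitions\<close>

lemma finite_cells [simp]: "finite D \<Longrightarrow> finite (cells D)"
  by (rule finite_subset[of _ "D \<times> D"]) (auto simp: cells_def)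

lemma cells_pair: "a < b \<Longrightarrow> cells {a, b} = {(a, b)}"
  by (auto simp: cells_def)

lemma riemann_sum_pair: "a < b \<Longrightarrow> riemann_sum F {a, b} = F a b"
  by (simp add: riemann_sum_def cells_pair)

lemma partitions_self: "a \<le> b \<Longrightarrow> {a, b} \<in> partitions a b"
  by (auto simp: partitions_def)

lemma riemann_sum_point: "D \<in> partitions a a \<Longrightarrow> riemann_sum F D = 0"
proof -
  assume "D \<in> partitions a a"
  then have "D = {a}" by (auto simp: partitions_def)
  moreover have "cells {a} = {}" by (auto simp: cells_def)
  ultimately show ?thesis by (simp add: riemann_sum_def)
qed

text \<open>The cell is bounded by the last node up to \<open>x\<close> and the first node from \<open>y\<close> on.\<close>

lemma cell_covering:
  assumes D: "D \<in> partitions a b" and "a \<le> x" "x < y" "y \<le> b" "D \<inter> {x<..<y} = {}"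
  obtains u v where "(u, v) \<in> cells D" "u \<le> x" "y \<le> v"
proof -
  let ?U = "{d \<in> D. d \<le> x}" and ?V = "{d \<in> D. y \<le> d}"
  have fin: "finite D" "a \<in> D" "b \<in> D" using D by (auto simp: partitions_def)
  have "?U \<noteq> {}" "?V \<noteq> {}" using fin assms by auto
  moreover have "finite ?U" "finite ?V" using fin by auto
  ultimately have U: "Max ?U \<in> ?U" and V: "Min ?V \<in> ?V"
    using Max_in Min_in by blast+
  have "d \<le> Max ?U \<or> Min ?V \<le> d" if "d \<in> D" for d
  proof -
    have "d \<le> x \<or> y \<le> d" using that assms(5) by (metis IntI empty_iff greaterThanLessThan_iff not_le)
    then show ?thesis using that fin(1) by auto
  qed
  then have "(Max ?U, Min ?V) \<in> cells D"
    using U V assms(3) by (fastforce simp: cells_def)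
  then show ?thesis using U V that by blast
qed

lemma cells_insert:
  assumes "(u, v) \<in> cells D" "u < x" "x < v"
  shows "cells (insert x D) = {(u, x), (x, v)} \<union> (cells D - {(u, v)})"
proof -
  have D: "u \<in> D" "v \<in> D" "\<And>d. d \<in> D \<Longrightarrow> d \<le> u \<or> v \<le> d"
    using assms by (auto simp: cells_def set_eq_iff not_le not_less)
  show ?thesis
  proof (intro subset_antisym subrelI)
    fix c d
    assume "(c, d) \<in> cells (insert x D)"
    then have cd: "c \<in> insert x D" "d \<in> insert x D" "c < d"
      "\<And>y. y \<in> insert x D \<Longrightarrow> y \<le> c \<or> d \<le> y"
      by (auto simp: cells_def set_eq_iff not_le not_less)
    consider "c = x" | "d = x" | "c \<in> D" "d \<in> D" using cd(1,2) by blast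
    then show "(c, d) \<in> {(u, x), (x, v)} \<union> (cells D - {(u, v)})"
    proof cases
      case 1
      then have "d \<in> D" using cd by auto
      then have "d = v" using 1 cd(3) cd(4)[of v] D(2) D(3)[of d] assms(2,3) by force
      with 1 show ?thesis by simp
    next
      case 2
      then have "c \<in> D" using cd by auto
      then have "c = u" using 2 cd(3) cd(4)[of u] D(1) D(3)[of c] assms(2,3) by force
      with 2 show ?thesis by simp
    next
      case 3
      have "D \<inter> {c<..<d} = {}" using cd(4) by fastforce
      moreover have "(c, d) \<noteq> (u, v)" using cd(4)[of x] assms(2,3) by auto
      ultimately show ?thesis using 3 cd(3) by (simp add: cells_def)
    qed
  next
    fix c d
    assume *: "(c, d) \<in> {(u, x), (x, v)} \<union> (cells D - {(u, v)})"
    show "(c, d) \<in> cells (insert x D)"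
    proof (cases "(c, d) \<in> cells D \<and> (c, d) \<noteq> (u, v)")
      case True
      then have cd: "c \<in> D" "d \<in> D" "c < d" "\<And>y. y \<in> D \<Longrightarrow> y \<le> c \<or> d \<le> y"
        by (auto simp: cells_def set_eq_iff not_le not_less)
      have "x \<le> c \<or> d \<le> x"
        using cd(1-3) cd(4)[of u] cd(4)[of v] D(1,2) D(3)[of c] D(3)[of d] assms(2,3) True by force
      then show ?thesis using cd by (force simp: cells_def)
    next
      case False
      with * have "(c, d) = (u, x) \<or> (c, d) = (x, v)" by auto
      then show ?thesis using D assms(2,3) by (force simp: cells_def)
    qed
  qed
qed

lemma riemann_sum_insert:
  assumes "finite D" "(u, v) \<in> cells D" "u < x" "x < v"
  shows "riemann_sum F (insert x D) = riemann_sum F D - F u v + F u x + F x v"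
proof -
  have "x \<notin> D" using assms by (auto simp: cells_def)
  then have "(u, x) \<notin> cells D" "(x, v) \<notin> cells D" by (auto simp: cells_def)
  then have "riemann_sum F (insert x D) = F u x + (F x v + sum (\<lambda>(u, v). F u v) (cells D - {(u, v)}))"
    unfolding riemann_sum_def cells_insert[OF assms(2-4)] using assms
    by (simp add: insert_commute)
  also have "sum (\<lambda>(u, v). F u v) (cells D - {(u, v)}) = riemann_sum F D - F u v"
    unfolding riemann_sum_def using assms by (subst sum_diff1) auto
  finally show ?thesis by simp
qed

lemma neighbours:
  assumes D: "D \<in> partitions a b" and "a < x" "x < b" "x \<notin> D"
  obtains u v where "(u, v) \<in> cells D" "u < x" "x < v"
proof -
  let ?S = "{d \<in> D. x < d}"
  have fin: "finite D" "a \<in> D" "b \<in> D" "D \<subseteq> {a..b}" using D by (auto simp: partitions_def)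
  define m where "m = Min ?S"
  have "m \<in> ?S" unfolding m_def using \<open>x < b\<close> fin by (intro Min_in) auto
  then have m: "m \<in> D" "x < m" by auto
  have "m \<le> d" if "d \<in> D" "x < d" for d
    unfolding m_def using that fin(1) by (intro Min_le) auto
  then have "D \<inter> {x<..<m} = {}" by (force simp: not_less)
  moreover have "a \<le> x" "m \<le> b" using m fin(4) \<open>a < x\<close> by auto
  ultimately obtain u v where uv: "(u, v) \<in> cells D" "u \<le> x" "m \<le> v"
    using cell_covering[OF D, of x m] m by blast
  then have "u \<noteq> x" using \<open>x \<notin> D\<close> by (auto simp: cells_def)
  with uv m that show ?thesis by force
qed

lemma insert_partition: "D \<in> partitions a b \<Longrightarrow> a \<le> x \<Longrightarrow> x \<le> b \<Longrightarrow> insert x D \<in> partitions a b"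
  by (auto simp: partitions_def)

text \<open>Every partition arises from the trivial one by inserting nodes, one at a time, each inside a
  cell.\<close>

lemma partition_induct [consumes 2, case_names pair insert]:
  assumes D: "D \<in> partitions a b" and "a < b"
    and pair: "P {a, b}"
    and step: "\<And>D u x v. D \<in> partitions a b \<Longrightarrow> (u, v) \<in> cells D \<Longrightarrow> u < x \<Longrightarrow> x < v \<Longrightarrow> P D
      \<Longrightarrow> P (insert x D)"
  shows "P D"
proof -
  have "{a, b} \<union> A \<in> partitions a b \<and> P ({a, b} \<union> A)" if "finite A" "A \<subseteq> {a<..<b}" for A
    using that
  proof (induction A rule: finite_induct)
    case empty
    then show ?case using pair \<open>a < b\<close> by (simp add: partitions_self)
  next
    case (insert x A)
    then have IH: "{a, b} \<union> A \<in> partitions a b" "P ({a, b} \<union> A)" by auto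
    obtain u v where "(u, v) \<in> cells ({a, b} \<union> A)" "u < x" "x < v"
      using neighbours[OF IH(1), of x] insert.prems insert.hyps by auto
    then have "P (insert x ({a, b} \<union> A))" using step IH by blast
    moreover have "insert x ({a, b} \<union> A) = {a, b} \<union> insert x A" by auto
    ultimately show ?case using insert_partition[OF IH(1), of x] insert.prems by auto
  qed
  from this[of "D - {a, b}"] show ?thesis
    using D by (simp add: partitions_def insert_absorb) (force simp: insert_absorb)
qed

lemma riemann_sum_superadditive:
  assumes D: "D \<in> partitions a b" and "a < b"
    and super: "\<And>s u t. a \<le> s \<Longrightarrow> s < u \<Longrightarrow> u < t \<Longrightarrow> t \<le> b \<Longrightarrow> g s u + g u t \<le> g s t"
  shows "riemann_sum g D \<le> g a b"
  using assms(1,2)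
proof (induction rule: partition_induct)
  case pair
  then show ?case using \<open>a < b\<close> by (simp add: riemann_sum_pair)
next
  case (insert D u x v)
  then have "a \<le> u" "v \<le> b" "finite D" by (auto simp: partitions_def cells_def)
  with insert super[of u x v] show ?case
    by (simp add: riemann_sum_insert)
qed

lemma riemann_sum_refinement:
  assumes D0: "D0 \<in> partitions a b" and D: "D \<in> partitions a b" and sub: "D0 \<subseteq> D"
  shows "riemann_sum F D = (\<Sum>(u, v)\<in>cells D0. riemann_sum F (D \<inter> {u..v}))"
proof -
  have fin: "finite D0" "finite D" using D0 D by (auto simp: partitions_def)
  have "cells D = (\<Union>c\<in>cells D0. cells (D \<inter> {fst c..snd c}))"
  proof (intro subset_antisym subrelI)
      fix x y assume xy: "(x, y) \<in> cells D"
      then have "a \<le> x" "x < y" "y \<le> b" "D0 \<inter> {x<..<y} = {}"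
        using D sub by (auto simp: cells_def partitions_def)
      then obtain u v where "(u, v) \<in> cells D0" "u \<le> x" "y \<le> v"
        using cell_covering[OF D0] by metis
      then show "(x, y) \<in> (\<Union>c\<in>cells D0. cells (D \<inter> {fst c..snd c}))"
        using xy by (intro UN_I[of "(u, v)"]) (auto simp: cells_def)
    next
      fix x y assume "(x, y) \<in> (\<Union>c\<in>cells D0. cells (D \<inter> {fst c..snd c}))"
      then show "(x, y) \<in> cells D" by (force simp: cells_def)
  qed
  then have "riemann_sum F D
      = (\<Sum>c\<in>cells D0. sum (\<lambda>(x, y). F x y) (cells (D \<inter> {fst c..snd c})))"
    unfolding riemann_sum_def
  proof (simp only:, intro sum.UNION_disjoint ballI impI)
    fix c c' assume "c \<in> cells D0" "c' \<in> cells D0" "c \<noteq> c'"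
    then have "snd c \<le> fst c' \<or> snd c' \<le> fst c"
      by (cases c; cases c') (force simp: cells_def set_eq_iff not_less)
    then show "cells (D \<inter> {fst c..snd c}) \<inter> cells (D \<inter> {fst c'..snd c'}) = {}"
      by (auto simp: cells_def)
  qed (use fin in auto)
  then show ?thesis by (simp add: riemann_sum_def case_prod_unfold)
qed

section \<open>Variation\<close>

text \<open>The \<open>q\<close>-th power of the \<open>q\<close>-variation norm. Unlike the norm it is superadditive over
  adjacent intervals.\<close>

definition power_variation :: "real \<Rightarrow> (real \<Rightarrow> real \<Rightarrow> real) \<Rightarrow> real set \<Rightarrow> ennreal" where
  "power_variation q F I =
     (SUP D\<in>\<Union>{partitions a b | a b. a \<le> b \<and> {a..b} \<subseteq> I}.
        ennreal (riemann_sum (\<lambda>u v. \<bar>F u v\<bar> powr q) D))"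

text \<open>The same as a real number; it is used where the variation is finite.\<close>

definition rvar :: "real \<Rightarrow> (real \<Rightarrow> real \<Rightarrow> real) \<Rightarrow> real set \<Rightarrow> real" where
  "rvar q F I = enn2real (power_variation q F I)"

lemma pvar_eq: "pvar q F I = ennpowr (power_variation q F I) (1 / q)"
  by (simp add: pvar_def power_variation_def riemann_sum_def)

lemma rvar_nonneg: "0 \<le> rvar q F I"
  by (simp add: rvar_def)

lemma riemann_sum_powr_nonneg: "0 \<le> riemann_sum (\<lambda>u v. \<bar>F u v\<bar> powr q) D"
  by (auto simp: riemann_sum_def intro!: sum_nonneg)

lemma power_variation_mono: "I \<subseteq> J \<Longrightarrow> power_variation q F I \<le> power_variation q F J"
  unfolding power_variation_def by (rule SUP_subset_mono) blast+

lemma power_variation_upper: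
  assumes "D \<in> partitions a b" "a \<le> b" "{a..b} \<subseteq> I"
  shows "ennreal (riemann_sum (\<lambda>u v. \<bar>F u v\<bar> powr q) D) \<le> power_variation q F I"
  unfolding power_variation_def by (rule SUP_upper) (use assms in blast)

lemma power_variation_empty [simp]: "power_variation q F {} = 0"
proof -
  have *: "\<Union>{partitions a b | a b. a \<le> b \<and> {a..b} \<subseteq> {}} = {}" by auto
  show ?thesis unfolding power_variation_def * by (simp add: bot_ennreal)
qed

text \<open>Partitions of compact subintervals of \<open>I\<close> and of \<open>J\<close> unite to a partition of a compact
  subinterval of \<open>K\<close>; the possible cell between them only adds a non-negative term.\<close>

lemma power_variation_superadditive:
  assumes "I \<subseteq> K" "J \<subseteq> K" and order: "\<And>x y. x \<in> I \<Longrightarrow> y \<in> J \<Longrightarrow> x \<le> y"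
    and convex: "\<And>x y. x \<in> K \<Longrightarrow> y \<in> K \<Longrightarrow> {x..y} \<subseteq> K"
  shows "power_variation q F I + power_variation q F J \<le> power_variation q F K"
proof (cases "I = {} \<or> J = {}")
  case True
  then show ?thesis using assms(1,2) by (elim disjE) (simp_all add: power_variation_mono)
next
  case False
  let ?f = "\<lambda>D. riemann_sum (\<lambda>u v. \<bar>F u v\<bar> powr q) D"
  let ?P = "\<lambda>I. \<Union>{partitions a b | a b. a \<le> b \<and> {a..b} \<subseteq> I}"
  have ne: "?P I \<noteq> {}" if "x \<in> I" for x and I :: "real set"
  proof -
    have "{x, x} \<in> ?P I" using that partitions_self[of x x] by force
    then show ?thesis by blast
  qed
  have le: "ennreal (?f D) + ennreal (?f E) \<le> power_variation q F K"
    if DE: "D \<in> ?P I" "E \<in> ?P J" for D E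
  proof -
    from DE obtain a b c d where D: "D \<in> partitions a b" "a \<le> b" "{a..b} \<subseteq> I"
      and E: "E \<in> partitions c d" "c \<le> d" "{c..d} \<subseteq> J" by blast
    have "a \<in> I" "b \<in> I" "c \<in> J" "d \<in> J"
      using D(2) E(2) subsetD[OF D(3)] subsetD[OF E(3)] by auto
    then have "b \<le> c" using order by blast
    have "a \<in> K" "d \<in> K" using \<open>a \<in> I\<close> \<open>d \<in> J\<close> assms(1,2) by auto
    then have ad: "{a..d} \<subseteq> K" by (rule convex)
    have fin: "finite D" "finite E" and DE_bounds: "b \<in> D" "c \<in> E"
      "\<And>x. x \<in> D \<Longrightarrow> a \<le> x \<and> x \<le> b" "\<And>x. x \<in> E \<Longrightarrow> c \<le> x \<and> x \<le> d"
      using D E by (auto simp: partitions_def)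
    have "D \<union> E \<in> partitions a d"
      using D E \<open>b \<le> c\<close> by (auto simp: partitions_def)
    then have "ennreal (?f (D \<union> E)) \<le> power_variation q F K"
      using D E \<open>b \<le> c\<close> ad by (intro power_variation_upper[of _ a d]) auto
    moreover have "cells D \<union> cells E \<subseteq> cells (D \<union> E)"
    proof (intro Un_least subrelI)
      fix x y assume xy: "(x, y) \<in> cells D"
      then have "E \<inter> {x<..<y} = {}"
        using DE_bounds(3)[of y] DE_bounds(4) \<open>b \<le> c\<close> by (force simp: cells_def)
      with xy show "(x, y) \<in> cells (D \<union> E)" by (simp add: cells_def Int_Un_distrib2)
    next
      fix x y assume xy: "(x, y) \<in> cells E"
      then have "D \<inter> {x<..<y} = {}"
        using DE_bounds(3) DE_bounds(4)[of x] \<open>b \<le> c\<close> by (force simp: cells_def)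
      with xy show "(x, y) \<in> cells (D \<union> E)" by (simp add: cells_def Int_Un_distrib2)
    qed
    moreover have "cells D \<inter> cells E = {}"
    proof -
      have False if "(x, y) \<in> cells D" "(x, y) \<in> cells E" for x y
        using that DE_bounds(3)[of y] DE_bounds(4)[of x] \<open>b \<le> c\<close> by (simp add: cells_def)
      then show ?thesis by auto
    qed
    ultimately have "?f D + ?f E \<le> ?f (D \<union> E)"
      unfolding riemann_sum_def using fin
      by (subst sum.union_disjoint[symmetric]) (auto intro!: sum_mono2)
    then have "ennreal (?f D) + ennreal (?f E) \<le> ennreal (?f (D \<union> E))"
      using ennreal_leI by (simp add: riemann_sum_powr_nonneg flip: ennreal_plus)
    also have "\<dots> \<le> power_variation q F K" by fact
    finally show ?thesis .
  qed
  have "ennreal (?f D) + power_variation q F J \<le> power_variation q F K" if "D \<in> ?P I" for D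
  proof -
    have "ennreal (?f D) + power_variation q F J = (SUP E\<in>?P J. ennreal (?f D) + ennreal (?f E))"
      unfolding power_variation_def using ne False by (subst ennreal_SUP_add_right) auto
    also have "\<dots> \<le> power_variation q F K"
      using le that by (intro SUP_least) blast
    finally show ?thesis .
  qed
  moreover have "power_variation q F I + power_variation q F J
      = (SUP D\<in>?P I. ennreal (?f D) + power_variation q F J)"
    unfolding power_variation_def[of _ _ I] using ne False by (subst ennreal_SUP_add_left) auto
  ultimately show ?thesis by (simp only:) (rule SUP_least, blast)
qed

lemma rvar_upper:
  assumes "power_variation q F I < \<infinity>" "D \<in> partitions a b" "a \<le> b" "{a..b} \<subseteq> I"
  shows "riemann_sum (\<lambda>u v. \<bar>F u v\<bar> powr q) D \<le> rvar q F I"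
  using enn2real_mono[OF power_variation_upper[OF assms(2-4), where F = F and q = q]] assms(1)
  by (simp add: rvar_def riemann_sum_powr_nonneg)

lemma rvar_mono: "power_variation q F J < \<infinity> \<Longrightarrow> I \<subseteq> J \<Longrightarrow> rvar q F I \<le> rvar q F J"
  by (simp add: rvar_def enn2real_mono power_variation_mono)

lemma power_variation_finite_mono:
  "power_variation q F J < \<infinity> \<Longrightarrow> I \<subseteq> J \<Longrightarrow> power_variation q F I < \<infinity>"
  using power_variation_mono le_less_trans by blast

lemma rvar_superadditive:
  assumes "power_variation q F K < \<infinity>" "I \<subseteq> K" "J \<subseteq> K" "\<And>x y. x \<in> I \<Longrightarrow> y \<in> J \<Longrightarrow> x \<le> y"
    and "\<And>x y. x \<in> K \<Longrightarrow> y \<in> K \<Longrightarrow> {x..y} \<subseteq> K"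
  shows "rvar q F I + rvar q F J \<le> rvar q F K"
proof -
  have "power_variation q F I < \<infinity>" "power_variation q F J < \<infinity>"
    using assms power_variation_finite_mono by blast+
  then have "rvar q F I + rvar q F J = enn2real (power_variation q F I + power_variation q F J)"
    by (simp add: rvar_def enn2real_plus)
  also have "\<dots> \<le> rvar q F K"
    unfolding rvar_def using assms by (intro enn2real_mono power_variation_superadditive) auto
  finally show ?thesis .
qed

lemma abs_powr_le_rvar:
  assumes "power_variation q F {u..v} < \<infinity>" "u < v"
  shows "\<bar>F u v\<bar> powr q \<le> rvar q F {u..v}"
  using rvar_upper[OF assms(1) partitions_self, of u v] assms by (simp add: riemann_sum_pair)

lemma rvar_approx:
  assumes fin: "power_variation q F I < \<infinity>" and "I \<noteq> {}" "0 < e"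
  obtains D a b where "D \<in> partitions a b" "a \<le> b" "{a..b} \<subseteq> I"
    "rvar q F I - e < riemann_sum (\<lambda>u v. \<bar>F u v\<bar> powr q) D"
proof (cases "rvar q F I = 0")
  case True
  obtain c where "c \<in> I" using \<open>I \<noteq> {}\<close> by blast
  show ?thesis
  proof (rule that[of "{c, c}" c c])
    show "rvar q F I - e < riemann_sum (\<lambda>u v. \<bar>F u v\<bar> powr q) {c, c}"
      using True \<open>0 < e\<close> riemann_sum_powr_nonneg[of F q "{c, c}"] by simp
  qed (use \<open>c \<in> I\<close> partitions_self[of c c] in auto)
next
  case False
  then have "ennreal (rvar q F I - e) < ennreal (rvar q F I)"
    using rvar_nonneg[of q F I] \<open>0 < e\<close> by (intro ennreal_lessI) auto
  also have "\<dots> = power_variation q F I"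
    using fin by (simp add: rvar_def)
  finally obtain D where D: "D \<in> \<Union>{partitions a b | a b. a \<le> b \<and> {a..b} \<subseteq> I}"
    "ennreal (rvar q F I - e) < ennreal (riemann_sum (\<lambda>u v. \<bar>F u v\<bar> powr q) D)"
    unfolding power_variation_def by (auto simp: less_SUP_iff)
  from D(2) have "rvar q F I - e < riemann_sum (\<lambda>u v. \<bar>F u v\<bar> powr q) D"
    by (meson ennreal_leI not_less)
  with D(1) that show ?thesis by blast
qed

text \<open>Some compact \<open>[c, d]\<close> inside \<open>(x, b]\<close> carries all of the variation over \<open>(x, b]\<close> up to \<open>e\<close>;
  by superadditivity at most \<open>e\<close> is left for \<open>(x, y]\<close> with \<open>y < c\<close>. A jump at \<open>x\<close> itself is not
  seen by the half-open interval, which is why the estimate of the integral is formulated with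
  half-open intervals.\<close>

lemma rvar_right_small:
  assumes fin: "power_variation q F {x<..b} < \<infinity>" and "x < b" "0 < e"
  shows "\<exists>\<delta>>0. \<forall>y. x < y \<and> y < x + \<delta> \<and> y \<le> b \<longrightarrow> rvar q F {x<..y} \<le> e"
proof -
  obtain D c d where D: "D \<in> partitions c d" "c \<le> d" "{c..d} \<subseteq> {x<..b}"
    "rvar q F {x<..b} - e < riemann_sum (\<lambda>u v. \<bar>F u v\<bar> powr q) D"
    using rvar_approx[OF fin _ \<open>0 < e\<close>] \<open>x < b\<close> by auto
  have "x < c" "d \<le> b" using D by auto
  have "rvar q F {x<..y} \<le> e" if "x < y" "y < c" "y \<le> b" for y
  proof -
    have "rvar q F {x<..y} + rvar q F {c..d} \<le> rvar q F {x<..b}"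
      by (rule rvar_superadditive[OF fin]) (use that \<open>x < c\<close> \<open>d \<le> b\<close> in auto)
    moreover have "riemann_sum (\<lambda>u v. \<bar>F u v\<bar> powr q) D \<le> rvar q F {c..d}"
      by (rule rvar_upper[OF power_variation_finite_mono[OF fin D(3)] D(1,2)]) simp
    ultimately show ?thesis using D(4) by linarith
  qed
  then show ?thesis using \<open>x < c\<close> by (intro exI[of _ "c - x"]) auto
qed

text \<open>The mirror image of \<open>rvar_right_small\<close>.\<close>

lemma rvar_left_small:
  assumes fin: "power_variation q F {a..<x} < \<infinity>" and "a < x" "0 < e"
  shows "\<exists>\<delta>>0. \<forall>y. x - \<delta> < y \<and> y < x \<and> a \<le> y \<longrightarrow> rvar q F {y..<x} \<le> e"
proof -
  obtain D c d where D: "D \<in> partitions c d" "c \<le> d" "{c..d} \<subseteq> {a..<x}"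
    "rvar q F {a..<x} - e < riemann_sum (\<lambda>u v. \<bar>F u v\<bar> powr q) D"
    using rvar_approx[OF fin _ \<open>0 < e\<close>] \<open>a < x\<close> by auto
  have "d < x" "a \<le> c" using D by auto
  have "rvar q F {y..<x} \<le> e" if "d < y" "y < x" "a \<le> y" for y
  proof -
    have "rvar q F {c..d} + rvar q F {y..<x} \<le> rvar q F {a..<x}"
      by (rule rvar_superadditive[OF fin]) (use that \<open>d < x\<close> \<open>a \<le> c\<close> in auto)
    moreover have "riemann_sum (\<lambda>u v. \<bar>F u v\<bar> powr q) D \<le> rvar q F {c..d}"
      by (rule rvar_upper[OF power_variation_finite_mono[OF fin D(3)] D(1,2)]) simp
    ultimately show ?thesis using D(4) by linarith
  qed
  then show ?thesis using \<open>d < x\<close> by (intro exI[of _ "x - d"]) auto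
qed


section \<open>Young's point-removal argument\<close>

definition left_neighbour :: "real set \<Rightarrow> real \<Rightarrow> real" where
  "left_neighbour D x = Max {y \<in> D. y < x}"

definition right_neighbour :: "real set \<Rightarrow> real \<Rightarrow> real" where
  "right_neighbour D x = Min {y \<in> D. x < y}"

lemma left_neighbour:
  assumes "finite D" "c \<in> D" "c < x"
  shows "left_neighbour D x \<in> D" "left_neighbour D x < x" "\<And>y. y \<in> D \<Longrightarrow> y < x \<Longrightarrow> y \<le> left_neighbour D x"
proof -
  have "Max {y \<in> D. y < x} \<in> {y \<in> D. y < x}"
    using assms by (intro Max_in) auto
  then show "left_neighbour D x \<in> D" "left_neighbour D x < x" by (auto simp: left_neighbour_def)
  show "\<And>y. y \<in> D \<Longrightarrow> y < x \<Longrightarrow> y \<le> left_neighbour D x"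
    unfolding left_neighbour_def using assms by (intro Max_ge) auto
qed

lemma right_neighbour:
  assumes "finite D" "c \<in> D" "x < c"
  shows "right_neighbour D x \<in> D" "x < right_neighbour D x" "\<And>y. y \<in> D \<Longrightarrow> x < y \<Longrightarrow> right_neighbour D x \<le> y"
proof -
  have "Min {y \<in> D. x < y} \<in> {y \<in> D. x < y}"
    using assms by (intro Min_in) auto
  then show "right_neighbour D x \<in> D" "x < right_neighbour D x" by (auto simp: right_neighbour_def)
  show "\<And>y. y \<in> D \<Longrightarrow> x < y \<Longrightarrow> right_neighbour D x \<le> y"
    unfolding right_neighbour_def using assms by (intro Min_le) auto
qed

lemma interior_point:
  "D \<in> partitions s t \<Longrightarrow> x \<in> D - {s, t} \<Longrightarrow> finite D \<and> s \<in> D \<and> t \<in> D \<and> s < x \<and> x < t"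
  by (force simp: partitions_def)

text \<open>The cells to the left of interior nodes are the cells of \<open>D\<close> without the node \<open>t\<close>, a
  partition of a compact subinterval of \<open>[s, t)\<close>. This is where the half-open interval comes
  from.\<close>

lemma sum_left_cells_le_rvar:
  assumes D: "D \<in> partitions s t" and fin: "power_variation q F {s..<t} < \<infinity>" and "s < t"
  shows "(\<Sum>x\<in>D - {s, t}. \<bar>F (left_neighbour D x) x\<bar> powr q) \<le> rvar q F {s..<t}"
proof -
  let ?c = "left_neighbour D t"
  have D': "finite D" "s \<in> D" "t \<in> D" "D \<subseteq> {s..t}" using D by (auto simp: partitions_def)
  note c = left_neighbour[OF D'(1,2) \<open>s < t\<close>]
  have E: "D - {t} \<in> partitions s ?c"
    using D' c \<open>s < t\<close> by (force simp: partitions_def)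
  have inj: "inj_on (\<lambda>x. (left_neighbour D x, x)) (D - {s, t})" by (rule inj_onI) simp
  have "(left_neighbour D x, x) \<in> cells (D - {t})" if "x \<in> D - {s, t}" for x
  proof -
    have "s < x" "x < t" using interior_point[OF D that] by auto
    note x = left_neighbour[OF D'(1,2) \<open>s < x\<close>]
    have "D \<inter> {left_neighbour D x<..<x} = {}" using x(3) by (force simp: not_less)
    then show ?thesis using x(1,2) that \<open>x < t\<close> by (auto simp: cells_def)
  qed
  then have "(\<lambda>x. (left_neighbour D x, x)) ` (D - {s, t}) \<subseteq> cells (D - {t})" by auto
  then have "(\<Sum>c\<in>(\<lambda>x. (left_neighbour D x, x)) ` (D - {s, t}). \<bar>F (fst c) (snd c)\<bar> powr q)
      \<le> (\<Sum>c\<in>cells (D - {t}). \<bar>F (fst c) (snd c)\<bar> powr q)"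
    using D' by (intro sum_mono2) auto
  then have "(\<Sum>x\<in>D - {s, t}. \<bar>F (left_neighbour D x) x\<bar> powr q) \<le> riemann_sum (\<lambda>u v. \<bar>F u v\<bar> powr q) (D - {t})"
    by (simp add: sum.reindex[OF inj] riemann_sum_def case_prod_unfold)
  also have "\<dots> \<le> rvar q F {s..<t}"
    using E c c(3)[OF D'(2) \<open>s < t\<close>] by (intro rvar_upper[OF fin E]) auto
  finally show ?thesis .
qed

text \<open>Symmetrically, the cells to the right of interior nodes avoid the node \<open>s\<close>.\<close>

lemma sum_right_cells_le_rvar:
  assumes D: "D \<in> partitions s t" and fin: "power_variation q F {s<..t} < \<infinity>" and "s < t"
  shows "(\<Sum>x\<in>D - {s, t}. \<bar>F x (right_neighbour D x)\<bar> powr q) \<le> rvar q F {s<..t}"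
proof -
  let ?c = "right_neighbour D s"
  have D': "finite D" "s \<in> D" "t \<in> D" "D \<subseteq> {s..t}" using D by (auto simp: partitions_def)
  note c = right_neighbour[OF D'(1,3) \<open>s < t\<close>]
  have E: "D - {s} \<in> partitions ?c t"
    using D' c \<open>s < t\<close> by (force simp: partitions_def)
  have inj: "inj_on (\<lambda>x. (x, right_neighbour D x)) (D - {s, t})" by (rule inj_onI) simp
  have "(x, right_neighbour D x) \<in> cells (D - {s})" if "x \<in> D - {s, t}" for x
  proof -
    have "s < x" "x < t" using interior_point[OF D that] by auto
    note x = right_neighbour[OF D'(1,3) \<open>x < t\<close>]
    have "D \<inter> {x<..<right_neighbour D x} = {}" using x(3) by (force simp: not_less)
    then show ?thesis using x(1,2) that \<open>s < x\<close> by (auto simp: cells_def)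
  qed
  then have "(\<lambda>x. (x, right_neighbour D x)) ` (D - {s, t}) \<subseteq> cells (D - {s})" by auto
  then have "(\<Sum>c\<in>(\<lambda>x. (x, right_neighbour D x)) ` (D - {s, t}). \<bar>F (fst c) (snd c)\<bar> powr q)
      \<le> (\<Sum>c\<in>cells (D - {s}). \<bar>F (fst c) (snd c)\<bar> powr q)"
    using D' by (intro sum_mono2) auto
  then have "(\<Sum>x\<in>D - {s, t}. \<bar>F x (right_neighbour D x)\<bar> powr q) \<le> riemann_sum (\<lambda>u v. \<bar>F u v\<bar> powr q) (D - {s})"
    by (simp add: sum.reindex[OF inj] riemann_sum_def case_prod_unfold)
  also have "\<dots> \<le> rvar q F {s<..t}"
    using E c c(3)[OF D'(3) \<open>s < t\<close>] by (intro rvar_upper[OF fin E]) auto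
  finally show ?thesis .
qed

text \<open>Pigeonhole. The ratios \<open>f h x / A h\<close> and \<open>g h x / B h\<close>, summed over all \<open>x\<close> and \<open>h\<close>, are at
  most \<open>2 * card H\<close>, so some \<open>x\<close> carries at most the average. Treating all \<open>h\<close> at once is
  essential: the node removed in Young's argument has to be the same for every \<open>h\<close>.\<close>

lemma common_small_index:
  fixes f g :: "'h \<Rightarrow> 'x \<Rightarrow> real" and A B :: "'h \<Rightarrow> real"
  assumes "finite H" "finite I" "I \<noteq> {}"
    and f: "\<And>h x. h \<in> H \<Longrightarrow> 0 \<le> f h x" "\<And>h. h \<in> H \<Longrightarrow> sum (f h) I \<le> A h"
    and g: "\<And>h x. h \<in> H \<Longrightarrow> 0 \<le> g h x" "\<And>h. h \<in> H \<Longrightarrow> sum (g h) I \<le> B h"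
  obtains x where "x \<in> I" "\<And>h. h \<in> H \<Longrightarrow> f h x \<le> A h * (2 * card H / card I)"
    "\<And>h. h \<in> H \<Longrightarrow> g h x \<le> B h * (2 * card H / card I)"
proof -
  define c where "c x = (\<Sum>h\<in>H. f h x / A h + g h x / B h)" for x
  let ?k = "2 * card H / card I :: real"
  have A: "0 \<le> A h" "0 \<le> B h" if "h \<in> H" for h
    using that f g by (meson order_trans sum_nonneg)+
  have "sum c I = (\<Sum>h\<in>H. sum (f h) I / A h + sum (g h) I / B h)"
    unfolding c_def by (subst sum.swap) (simp add: sum.distrib sum_divide_distrib)
  also have "\<dots> \<le> (\<Sum>h\<in>H. 2)"
  proof (rule sum_mono)
    fix h assume h: "h \<in> H"
    have "sum (f h) I / A h \<le> 1" "sum (g h) I / B h \<le> 1"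
      using f(2)[OF h] g(2)[OF h] A[OF h] by (auto simp: divide_le_eq_1)
    then show "sum (f h) I / A h + sum (g h) I / B h \<le> 2" by simp
  qed
  also have "\<dots> = card I * ?k" using assms by simp
  finally have le: "sum c I \<le> (\<Sum>x\<in>I. ?k)" by simp
  have "\<exists>x\<in>I. c x \<le> ?k"
  proof (rule ccontr)
    assume "\<not> ?thesis"
    then have "(\<Sum>x\<in>I. ?k) < sum c I"
      using assms(2,3) by (intro sum_strict_mono) auto
    with le show False by simp
  qed
  then obtain x where x: "x \<in> I" "c x \<le> ?k" by blast
  \<comment> \<open>If \<open>A h = 0\<close>, the ratio is \<open>0\<close> by the convention for division; then \<open>f h\<close> vanishes on \<open>I\<close>,
    which is what \<open>mem\<close> is for.\<close>
  have terms: "f h x / A h \<le> ?k" "g h x / B h \<le> ?k" if h: "h \<in> H" for h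
  proof -
    have "f h x / A h + g h x / B h \<le> c x"
      unfolding c_def using assms(1) h f(1) g(1) A by (intro member_le_sum) auto
    moreover have "0 \<le> f h x / A h" "0 \<le> g h x / B h" using h f(1) g(1) A by auto
    ultimately show "f h x / A h \<le> ?k" "g h x / B h \<le> ?k" using x(2) by linarith+
  qed
  have mem: "f h x \<le> A h" "g h x \<le> B h" if "h \<in> H" for h
    using member_le_sum[of x I "f h"] member_le_sum[of x I "g h"] assms(2) x(1) f g that
    by (meson order_trans)+
  show ?thesis
  proof (rule that[OF x(1)])
    fix h assume h: "h \<in> H"
    show "f h x \<le> A h * ?k"
      using terms(1)[OF h] mem(1)[OF h] A(1)[OF h]
      by (cases "A h = 0") (auto simp: pos_divide_le_eq mult.commute)
    show "g h x \<le> B h * ?k"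
      using terms(2)[OF h] mem(2)[OF h] A(2)[OF h]
      by (cases "B h = 0") (auto simp: pos_divide_le_eq mult.commute)
  qed
qed

lemma abs_le_powr_of_powr_inverse_le:
  fixes r :: real
  assumes "\<bar>r\<bar> powr (1 / \<alpha>) \<le> c" "0 < \<alpha>"
  shows "\<bar>r\<bar> \<le> c powr \<alpha>"
proof -
  have "\<bar>r\<bar> = (\<bar>r\<bar> powr (1 / \<alpha>)) powr \<alpha>" using assms by (simp add: powr_powr)
  also have "\<dots> \<le> c powr \<alpha>" using assms by (intro powr_mono2) auto
  finally show ?thesis .
qed

text \<open>Since \<open>\<alpha> + \<beta> > 1\<close>, exponents \<open>\<alpha>' + (1 - \<alpha>') = 1\<close> can be split off, which give at most
  \<open>A + B\<close>. Of what remains, the power of \<open>A\<close> is bounded and the power of \<open>B\<close> has a positive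
  exponent, hence is small with \<open>B\<close>.\<close>

lemma young_product_small_right:
  fixes \<alpha> \<beta> k \<eta> :: real
  assumes "0 < \<alpha>" "0 < \<beta>" "1 < \<alpha> + \<beta>" "0 < \<eta>"
  shows "\<exists>\<epsilon>>0. \<forall>A B. 0 \<le> A \<and> A \<le> k \<and> 0 \<le> B \<and> B \<le> \<epsilon> \<longrightarrow> A powr \<alpha> * B powr \<beta> \<le> \<eta> * (A + B)"
proof -
  \<comment> \<open>With \<open>\<alpha>' \<le> 1\<close> as large as possible, both leftover exponents \<open>\<alpha> - \<alpha>'\<close> and \<open>\<delta>\<close> are
    non-negative, and \<open>\<epsilon>\<close> solves \<open>c * \<epsilon> powr \<delta> = \<eta>\<close>.\<close>
  define \<alpha>' where "\<alpha>' = min \<alpha> 1"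
  define \<delta> where "\<delta> = \<beta> - (1 - \<alpha>')"
  define c where "c = k powr (\<alpha> - \<alpha>') + 1"
  have \<alpha>': "0 \<le> \<alpha>'" "\<alpha>' \<le> \<alpha>" "\<alpha>' \<le> 1" and \<delta>: "0 < \<delta>"
    using assms by (auto simp: \<alpha>'_def \<delta>_def min_def)
  have c: "0 < c" by (simp add: c_def add_nonneg_pos)
  define \<epsilon> where "\<epsilon> = (\<eta> / c) powr (1 / \<delta>)"
  have "\<epsilon> > 0" using assms c by (simp add: \<epsilon>_def)
  moreover have "A powr \<alpha> * B powr \<beta> \<le> \<eta> * (A + B)" if "0 \<le> A" "A \<le> k" "0 \<le> B" "B \<le> \<epsilon>" for A B
  proof -
    have "A powr \<alpha> = A powr (\<alpha> - \<alpha>') * A powr \<alpha>'" "B powr \<beta> = B powr \<delta> * B powr (1 - \<alpha>')"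
      by (simp_all add: \<delta>_def flip: powr_add)
    then have "A powr \<alpha> * B powr \<beta> = (A powr (\<alpha> - \<alpha>') * B powr \<delta>) * (A powr \<alpha>' * B powr (1 - \<alpha>'))"
      by simp
    also have "\<dots> \<le> (c * (\<eta> / c)) * ((A + B) powr \<alpha>' * (A + B) powr (1 - \<alpha>'))"
    proof (intro mult_mono)
      have "A powr (\<alpha> - \<alpha>') \<le> k powr (\<alpha> - \<alpha>')" using that \<alpha>' by (intro powr_mono2) auto
      then show "A powr (\<alpha> - \<alpha>') \<le> c" by (simp add: c_def)
      have "B powr \<delta> \<le> \<epsilon> powr \<delta>" using that \<delta> by (intro powr_mono2) auto
      also have "\<dots> = \<eta> / c" using \<delta> c assms by (simp add: \<epsilon>_def powr_powr)
      finally show "B powr \<delta> \<le> \<eta> / c" .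
      show "A powr \<alpha>' \<le> (A + B) powr \<alpha>'" "B powr (1 - \<alpha>') \<le> (A + B) powr (1 - \<alpha>')"
        using that \<alpha>' by (intro powr_mono2; simp)+
    qed (use c assms in auto)
    also have "\<dots> = \<eta> * (A + B)" using c that by (simp flip: powr_add)
    finally show ?thesis .
  qed
  ultimately show ?thesis by blast
qed

lemma young_product_small:
  fixes \<alpha> \<beta> k \<eta> :: real
  assumes "0 < \<alpha>" "0 < \<beta>" "1 < \<alpha> + \<beta>" "0 < \<eta>"
  obtains \<epsilon> where "0 < \<epsilon>" "\<And>A B. 0 \<le> A \<Longrightarrow> A \<le> k \<Longrightarrow> 0 \<le> B \<Longrightarrow> B \<le> k \<Longrightarrow> A \<le> \<epsilon> \<or> B \<le> \<epsilon> \<Longrightarrow>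
    A powr \<alpha> * B powr \<beta> \<le> \<eta> * (A + B)"
proof -
  obtain e1 where e1: "0 < e1"
    "\<And>A B. 0 \<le> A \<Longrightarrow> A \<le> k \<Longrightarrow> 0 \<le> B \<Longrightarrow> B \<le> e1 \<Longrightarrow> A powr \<alpha> * B powr \<beta> \<le> \<eta> * (A + B)"
    using young_product_small_right[OF assms, of k] by blast
  have "1 < \<beta> + \<alpha>" using assms by simp
  from young_product_small_right[OF assms(2,1) this assms(4), of k] obtain e2 where e2: "0 < e2"
    "\<And>A B. 0 \<le> A \<Longrightarrow> A \<le> k \<Longrightarrow> 0 \<le> B \<Longrightarrow> B \<le> e2 \<Longrightarrow> A powr \<beta> * B powr \<alpha> \<le> \<eta> * (A + B)"
    by blast
  show ?thesis
  proof (rule that[of "min e1 e2"])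
    fix A B :: real assume AB: "0 \<le> A" "A \<le> k" "0 \<le> B" "B \<le> k" "A \<le> min e1 e2 \<or> B \<le> min e1 e2"
    then show "A powr \<alpha> * B powr \<beta> \<le> \<eta> * (A + B)"
      using e1(2)[of A B] e2(2)[of B A] by (auto simp: mult.commute add.commute)
  qed (use e1 e2 in auto)
qed

section \<open>Limits of Riemann sums\<close>

lemma union_partition: "D \<in> partitions s t \<Longrightarrow> E \<in> partitions s t \<Longrightarrow> D \<union> E \<in> partitions s t"
  by (auto simp: partitions_def)

lemma RRS_limit_unique:
  assumes "RRS_limit \<Xi> s t K" "RRS_limit \<Xi> s t L"
  shows "K = L"
proof (rule ccontr)
  assume "K \<noteq> L"
  define \<epsilon> where "\<epsilon> = \<bar>K - L\<bar> / 2"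
  have "\<epsilon> > 0" using \<open>K \<noteq> L\<close> by (simp add: \<epsilon>_def)
  obtain D where D: "D \<in> partitions s t" "\<And>E. E \<in> partitions s t \<Longrightarrow> D \<subseteq> E \<Longrightarrow> \<bar>riemann_sum \<Xi> E - K\<bar> < \<epsilon>"
    using assms(1)[unfolded RRS_limit_def, rule_format, OF \<open>\<epsilon> > 0\<close>] by blast
  obtain D' where D': "D' \<in> partitions s t" "\<And>E. E \<in> partitions s t \<Longrightarrow> D' \<subseteq> E \<Longrightarrow> \<bar>riemann_sum \<Xi> E - L\<bar> < \<epsilon>"
    using assms(2)[unfolded RRS_limit_def, rule_format, OF \<open>\<epsilon> > 0\<close>] by blast
  have "D \<union> D' \<in> partitions s t" using D D' by (intro union_partition)
  then have "\<bar>riemann_sum \<Xi> (D \<union> D') - K\<bar> < \<epsilon>" "\<bar>riemann_sum \<Xi> (D \<union> D') - L\<bar> < \<epsilon>"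
    using D(2) D'(2) by blast+
  then show False unfolding \<epsilon>_def by (simp add: abs_if split: if_splits)
qed

text \<open>Partitions are directed by inclusion, so the Cauchy condition for nets applies; along a
  sequence \<open>P n\<close> of partitions with error \<open>1 / (n + 1)\<close> the sums form a Cauchy sequence of reals.\<close>

lemma RRS_limit_if_cauchy:
  assumes cauchy: "\<And>\<epsilon>. 0 < \<epsilon> \<Longrightarrow> \<exists>D0\<in>partitions s t. \<forall>D\<in>partitions s t. D0 \<subseteq> D \<longrightarrow>
    \<bar>riemann_sum \<Xi> D - riemann_sum \<Xi> D0\<bar> \<le> \<epsilon>"
  shows "\<exists>K. RRS_limit \<Xi> s t K"
proof -
  let ?S = "riemann_sum \<Xi>"
  have "\<exists>D0\<in>partitions s t. \<forall>D\<in>partitions s t. D0 \<subseteq> D \<longrightarrow> \<bar>?S D - ?S D0\<bar> \<le> inverse (Suc n)" for n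
    by (rule cauchy) simp
  then obtain P where P: "\<And>n. P n \<in> partitions s t"
    "\<And>n D. D \<in> partitions s t \<Longrightarrow> P n \<subseteq> D \<Longrightarrow> \<bar>?S D - ?S (P n)\<bar> \<le> inverse (Suc n)"
    by metis
  have diff: "\<bar>?S (P m) - ?S (P n)\<bar> \<le> inverse (Suc m) + inverse (Suc n)" for m n
    using P(2)[OF union_partition[OF P(1)[of m] P(1)[of n]], of m]
      P(2)[OF union_partition[OF P(1)[of m] P(1)[of n]], of n] by auto
  have "Cauchy (\<lambda>n. ?S (P n))"
  proof (rule metric_CauchyI)
    fix e :: real assume "0 < e"
    then obtain N where N: "inverse (real (Suc N)) < e / 2" using reals_Archimedean[of "e / 2"] by auto
    have "dist (?S (P m)) (?S (P n)) < e" if "m \<ge> N" "n \<ge> N" for m n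
    proof -
      have "inverse (real (Suc m)) \<le> inverse (real (Suc N))" "inverse (real (Suc n)) \<le> inverse (real (Suc N))"
        using that by (auto intro!: le_imp_inverse_le)
      then show ?thesis unfolding dist_real_def using diff[of m n] N by linarith
    qed
    then show "\<exists>M. \<forall>m\<ge>M. \<forall>n\<ge>M. dist (?S (P m)) (?S (P n)) < e" by blast
  qed
  then obtain K where K: "(\<lambda>n. ?S (P n)) \<longlonglongrightarrow> K"
    using Cauchy_convergent convergent_def by blast
  have "RRS_limit \<Xi> s t K"
    unfolding RRS_limit_def
  proof (intro allI impI)
    fix e :: real assume "0 < e"
    then obtain N where N: "inverse (real (Suc N)) < e / 2" using reals_Archimedean[of "e / 2"] by auto
    obtain M where M: "\<And>n. n \<ge> M \<Longrightarrow> \<bar>?S (P n) - K\<bar> < e / 2"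
      using LIMSEQ_D[OF K, of "e / 2"] \<open>0 < e\<close> unfolding real_norm_def by auto
    let ?n = "max M N"
    have "inverse (real (Suc ?n)) \<le> inverse (real (Suc N))" by (intro le_imp_inverse_le) auto
    then have "\<bar>?S D - K\<bar> < e" if "D \<in> partitions s t" "P ?n \<subseteq> D" for D
      using P(2)[OF that] M[OF max.cobounded1, of N] N by linarith
    then show "\<exists>D0\<in>partitions s t. \<forall>D\<in>partitions s t. D0 \<subseteq> D \<longrightarrow> \<bar>?S D - K\<bar> < e"
      using P(1) by blast
  qed
  then show ?thesis by blast
qed

lemma cell_le_mesh: "finite D \<Longrightarrow> (u, v) \<in> cells D \<Longrightarrow> v - u \<le> mesh D"
  unfolding mesh_def by (rule Max_ge) (auto intro!: image_eqI[of _ _ "(u, v)"])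

lemma cells_union_adjacent:
  assumes "D \<in> partitions a b" "E \<in> partitions b c"
  shows "cells (D \<union> E) \<subseteq> cells D \<union> cells E"
proof (rule subrelI)
  fix x y assume xy: "(x, y) \<in> cells (D \<union> E)"
  have DE: "b \<in> D" "b \<in> E" "D \<subseteq> {a..b}" "E \<subseteq> {b..c}" using assms by (auto simp: partitions_def)
  have xy': "x \<in> D \<union> E" "y \<in> D \<union> E" "x < y" "D \<inter> {x<..<y} = {}" "E \<inter> {x<..<y} = {}"
    using xy by (auto simp: cells_def Int_Un_distrib2)
  have "b \<le> x \<or> y \<le> b" using xy'(4) DE(1) by (metis IntI empty_iff greaterThanLessThan_iff not_le)
  then show "(x, y) \<in> cells D \<union> cells E"
  proof
    assume "b \<le> x"
    then have "x \<in> E" "y \<in> E" using xy'(1-3) DE by fastforce+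
    then show ?thesis using xy' by (simp add: cells_def)
  next
    assume "y \<le> b"
    then have "x \<in> D" "y \<in> D" using xy'(1-3) DE by fastforce+
    then show ?thesis using xy' by (simp add: cells_def)
  qed
qed


section \<open>Sewing of germs with a Young-type defect\<close>

text \<open>The germs covered by Young's method: the defect of additivity is a finite sum of products,
  whose factors have finite variation of orders \<open>1 / \<alpha> h\<close> and \<open>1 / \<beta> h\<close> with \<open>\<alpha> h + \<beta> h = \<theta> > 1\<close>.\<close>

locale young_germ =
  fixes a b \<theta> :: real and H :: "'h set" and R Y :: "'h \<Rightarrow> real \<Rightarrow> real \<Rightarrow> real"
    and \<alpha> \<beta> :: "'h \<Rightarrow> real" and \<Xi> :: "real \<Rightarrow> real \<Rightarrow> real"
  assumes finite_H: "finite H" and \<theta>: "1 < \<theta>"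
    and \<alpha>: "h \<in> H \<Longrightarrow> 0 < \<alpha> h" and \<beta>: "h \<in> H \<Longrightarrow> 0 < \<beta> h"
    and exponents: "h \<in> H \<Longrightarrow> \<alpha> h + \<beta> h = \<theta>"
    and R_finite: "h \<in> H \<Longrightarrow> power_variation (1 / \<alpha> h) (R h) {a..b} < \<infinity>"
    and Y_finite: "h \<in> H \<Longrightarrow> power_variation (1 / \<beta> h) (Y h) {a..b} < \<infinity>"
    and \<Xi>_self: "a \<le> s \<Longrightarrow> s \<le> b \<Longrightarrow> \<Xi> s s = 0"
    and defect: "a \<le> s \<Longrightarrow> s \<le> u \<Longrightarrow> u \<le> t \<Longrightarrow> t \<le> b \<Longrightarrow>
      \<Xi> s t = \<Xi> s u + \<Xi> u t - (\<Sum>h\<in>H. R h s u * Y h u t)"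
begin

text \<open>The functionals \<open>A\<close> and \<open>B\<close> are the variations of the left and right factors over the
  half-open intervals that interior nodes see. Their powers with exponents \<open>\<alpha> h\<close> and \<open>\<beta> h\<close> are the
  variation norms.\<close>

definition A :: "'h \<Rightarrow> real \<Rightarrow> real \<Rightarrow> real" where
  "A h s t = rvar (1 / \<alpha> h) (R h) {s..<t}"

definition B :: "'h \<Rightarrow> real \<Rightarrow> real \<Rightarrow> real" where
  "B h s t = rvar (1 / \<beta> h) (Y h) {s<..t}"

definition young_bound :: "real \<Rightarrow> real \<Rightarrow> real" where
  "young_bound s t = (\<Sum>h\<in>H. A h s t powr \<alpha> h * B h s t powr \<beta> h)"

text \<open>Removing a suitable one of \<open>n\<close> interior nodes costs at most \<open>(2 * card H)\<^sup>\<theta> n\<^sup>-\<^sup>\<theta>\<close> times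
  \<open>young_bound\<close>; the series is \<open>\<zeta>(\<theta>)\<close>.\<close>

definition young_const :: real where
  "young_const = (2 * card H) powr \<theta> * suminf (\<lambda>k. real (Suc k) powr - \<theta>)"

lemma A_nonneg: "0 \<le> A h s t" and B_nonneg: "0 \<le> B h s t"
  by (simp_all add: A_def B_def rvar_nonneg)

lemma young_bound_nonneg: "0 \<le> young_bound s t"
  by (simp add: young_bound_def sum_nonneg)

lemma summable_powr: "summable (\<lambda>k. real (Suc k) powr - \<theta>)"
  using \<theta> summable_real_powr_iff[of "- \<theta>"] by (subst summable_Suc_iff) simp

lemma young_const_nonneg: "0 \<le> young_const"
  unfolding young_const_def by (intro mult_nonneg_nonneg suminf_nonneg summable_powr) auto

lemma variation_finite:
  assumes "h \<in> H" "I \<subseteq> {a..b}"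
  shows "power_variation (1 / \<alpha> h) (R h) I < \<infinity>" "power_variation (1 / \<beta> h) (Y h) I < \<infinity>"
  using power_variation_finite_mono R_finite Y_finite assms by blast+

text \<open>Removing an interior node \<open>x\<close> changes the Riemann sum by the defect at \<open>x\<close> and its
  neighbours. For the node chosen by \<open>common_small_index\<close>, every factor is at most a fraction
  \<open>2 * card H / n\<close> of its total variation, raised to its exponent; the two exponents add up to
  \<open>\<theta>\<close>.\<close>

lemma one_point_removal:
  assumes D: "D \<in> partitions s t" and st: "a \<le> s" "t \<le> b" and ne: "D - {s, t} \<noteq> {}"
  obtains x where "x \<in> D - {s, t}"
    "\<bar>riemann_sum \<Xi> D - riemann_sum \<Xi> (D - {x})\<bar>
      \<le> (2 * card H) powr \<theta> * real (card (D - {s, t})) powr - \<theta> * young_bound s t"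
proof -
  let ?I = "D - {s, t}"
  define k where "k = 2 * real (card H) / real (card ?I)"
  have k: "0 \<le> k" by (simp add: k_def)
  have fin: "finite D" "s \<in> D" "t \<in> D" "D \<subseteq> {s..t}" using D by (auto simp: partitions_def)
  have "s < t" using ne interior_point[OF D] by (metis ex_in_conv less_trans)
  have sub: "{s..<t} \<subseteq> {a..b}" "{s<..t} \<subseteq> {a..b}" using st by auto
  obtain x where x: "x \<in> ?I"
    and xR: "\<And>h. h \<in> H \<Longrightarrow> \<bar>R h (left_neighbour D x) x\<bar> powr (1 / \<alpha> h) \<le> A h s t * k"
    and xY: "\<And>h. h \<in> H \<Longrightarrow> \<bar>Y h x (right_neighbour D x)\<bar> powr (1 / \<beta> h) \<le> B h s t * k"
    unfolding k_def
  proof (rule common_small_index[of H ?I "\<lambda>h x. \<bar>R h (left_neighbour D x) x\<bar> powr (1 / \<alpha> h)" "\<lambda>h. A h s t"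
      "\<lambda>h x. \<bar>Y h x (right_neighbour D x)\<bar> powr (1 / \<beta> h)" "\<lambda>h. B h s t"])
    fix h assume h: "h \<in> H"
    show "(\<Sum>x\<in>?I. \<bar>R h (left_neighbour D x) x\<bar> powr (1 / \<alpha> h)) \<le> A h s t"
      unfolding A_def by (rule sum_left_cells_le_rvar[OF D variation_finite(1)[OF h sub(1)] \<open>s < t\<close>])
    show "(\<Sum>x\<in>?I. \<bar>Y h x (right_neighbour D x)\<bar> powr (1 / \<beta> h)) \<le> B h s t"
      unfolding B_def by (rule sum_right_cells_le_rvar[OF D variation_finite(2)[OF h sub(2)] \<open>s < t\<close>])
  qed (use finite_H fin ne in auto)
  let ?u = "left_neighbour D x" and ?v = "right_neighbour D x"
  have "s < x" "x < t" using interior_point[OF D x] by auto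
  note u = left_neighbour[OF fin(1,2) \<open>s < x\<close>] and v = right_neighbour[OF fin(1,3) \<open>x < t\<close>]
  have "(D - {x}) \<inter> {?u<..<?v} = {}"
    using u(3) v(3) by (metis (no_types, lifting) DiffE Int_emptyI greaterThanLessThan_iff insertI1
        linorder_cases not_le)
  then have cell: "(?u, ?v) \<in> cells (D - {x})" using u v by (auto simp: cells_def)
  have "insert x (D - {x}) = D" using x by auto
  then have "riemann_sum \<Xi> D = riemann_sum \<Xi> (D - {x}) - \<Xi> ?u ?v + \<Xi> ?u x + \<Xi> x ?v"
    using riemann_sum_insert[OF _ cell u(2) v(2), of \<Xi>] fin(1) by simp
  also have "\<Xi> ?u ?v = \<Xi> ?u x + \<Xi> x ?v - (\<Sum>h\<in>H. R h ?u x * Y h x ?v)"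
    using u v st fin(4) by (intro defect) auto
  finally have "\<bar>riemann_sum \<Xi> D - riemann_sum \<Xi> (D - {x})\<bar> = \<bar>\<Sum>h\<in>H. R h ?u x * Y h x ?v\<bar>"
    by simp
  also have "\<dots> \<le> (\<Sum>h\<in>H. \<bar>R h ?u x * Y h x ?v\<bar>)" by (rule sum_abs)
  also have "\<dots> \<le> (\<Sum>h\<in>H. A h s t powr \<alpha> h * B h s t powr \<beta> h * k powr \<theta>)"
  proof (rule sum_mono)
    fix h assume h: "h \<in> H"
    have "\<bar>R h ?u x * Y h x ?v\<bar> \<le> (A h s t * k) powr \<alpha> h * (B h s t * k) powr \<beta> h"
      unfolding abs_mult using h \<alpha> \<beta> xR xY
      by (intro mult_mono abs_le_powr_of_powr_inverse_le) auto
    also have "\<dots> = A h s t powr \<alpha> h * B h s t powr \<beta> h * k powr (\<alpha> h + \<beta> h)"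
      using k by (simp add: powr_mult powr_add A_nonneg B_nonneg)
    finally show "\<bar>R h ?u x * Y h x ?v\<bar> \<le> A h s t powr \<alpha> h * B h s t powr \<beta> h * k powr \<theta>"
      by (simp add: exponents h)
  qed
  also have "\<dots> = k powr \<theta> * young_bound s t"
    by (simp add: young_bound_def sum_distrib_left mult.commute)
  also have "k powr \<theta> = (2 * card H) powr \<theta> * real (card ?I) powr - \<theta>"
    unfolding k_def by (subst powr_divide) (auto simp: powr_minus divide_inverse)
  finally show ?thesis using x that by simp
qed

lemma young_partial_bound:
  assumes "D \<in> partitions s t" "a \<le> s" "t \<le> b" "s < t"
  shows "\<bar>riemann_sum \<Xi> D - \<Xi> s t\<bar>
    \<le> (2 * card H) powr \<theta> * (\<Sum>k<card (D - {s, t}). real (Suc k) powr - \<theta>) * young_bound s t"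
  using assms(1)
proof (induction "card (D - {s, t})" arbitrary: D)
  case 0
  then have "D = {s, t}" by (auto simp: partitions_def)
  then show ?case using \<open>s < t\<close> by (simp add: riemann_sum_pair)
next
  case (Suc n)
  have ne: "D - {s, t} \<noteq> {}" using Suc.hyps(2) by (metis card.empty nat.distinct(1))
  obtain x where x: "x \<in> D - {s, t}" "\<bar>riemann_sum \<Xi> D - riemann_sum \<Xi> (D - {x})\<bar>
      \<le> (2 * card H) powr \<theta> * real (card (D - {s, t})) powr - \<theta> * young_bound s t"
    using one_point_removal[OF Suc.prems assms(2,3) ne] by blast
  have D: "D - {x} \<in> partitions s t" using x(1) Suc.prems by (auto simp: partitions_def)
  have "D - {x} - {s, t} = D - {s, t} - {x}" by auto
  then have card: "card (D - {x} - {s, t}) = n"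
    using x(1) Suc.prems Suc.hyps(2) by (simp add: partitions_def)
  have "\<bar>riemann_sum \<Xi> D - \<Xi> s t\<bar>
      \<le> \<bar>riemann_sum \<Xi> D - riemann_sum \<Xi> (D - {x})\<bar> + \<bar>riemann_sum \<Xi> (D - {x}) - \<Xi> s t\<bar>"
    by simp
  also have "\<dots> \<le> (2 * card H) powr \<theta> * real (Suc n) powr - \<theta> * young_bound s t
      + (2 * card H) powr \<theta> * (\<Sum>k<n. real (Suc k) powr - \<theta>) * young_bound s t"
    using x(2) Suc.hyps(1)[OF card[symmetric] D] unfolding card Suc.hyps(2)[symmetric] by linarith
  finally show ?case
    unfolding Suc.hyps(2)[symmetric] by (simp add: algebra_simps)
qed

text \<open>The bound is uniform in the partition because \<open>\<theta> > 1\<close> makes the costs of the removals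
  summable.\<close>

theorem young_maximal_bound:
  assumes "D \<in> partitions s t" "a \<le> s" "t \<le> b" "s < t"
  shows "\<bar>riemann_sum \<Xi> D - \<Xi> s t\<bar> \<le> young_const * young_bound s t"
proof -
  have "(\<Sum>k<card (D - {s, t}). real (Suc k) powr - \<theta>) \<le> suminf (\<lambda>k. real (Suc k) powr - \<theta>)"
    using summable_powr by (intro sum_le_suminf) auto
  then have "(2 * card H) powr \<theta> * (\<Sum>k<card (D - {s, t}). real (Suc k) powr - \<theta>) * young_bound s t
      \<le> young_const * young_bound s t"
    unfolding young_const_def by (intro mult_right_mono mult_left_mono young_bound_nonneg) auto
  then show ?thesis using young_partial_bound[OF assms] by linarith
qed

text \<open>The maximal bound, applied inside every cell of the coarser partition.\<close>

lemma refinement_bound: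
  assumes D0: "D0 \<in> partitions s t" and D: "D \<in> partitions s t" "D0 \<subseteq> D" and st: "a \<le> s" "t \<le> b"
  shows "\<bar>riemann_sum \<Xi> D - riemann_sum \<Xi> D0\<bar> \<le> young_const * riemann_sum young_bound D0"
proof -
  have fin: "finite (cells D0)" using D0 by (auto simp: partitions_def)
  have "riemann_sum \<Xi> D - riemann_sum \<Xi> D0
      = (\<Sum>c\<in>cells D0. riemann_sum \<Xi> (D \<inter> {fst c..snd c}) - \<Xi> (fst c) (snd c))"
    by (simp add: riemann_sum_refinement[OF D0 D, of \<Xi>] sum_subtractf case_prod_unfold
        riemann_sum_def[of \<Xi> D0])
  also have "\<bar>\<dots>\<bar> \<le> (\<Sum>c\<in>cells D0. young_const * young_bound (fst c) (snd c))"
  proof (rule order_trans[OF sum_abs sum_mono])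
    fix c assume "c \<in> cells D0"
    then obtain u v where c: "c = (u, v)" "u \<in> D0" "v \<in> D0" "u < v" by (auto simp: cells_def)
    have "D \<inter> {u..v} \<in> partitions u v" "s \<le> u" "v \<le> t"
      using c D D0 by (auto simp: partitions_def)
    then show "\<bar>riemann_sum \<Xi> (D \<inter> {fst c..snd c}) - \<Xi> (fst c) (snd c)\<bar>
        \<le> young_const * young_bound (fst c) (snd c)"
      using young_maximal_bound[of "D \<inter> {u..v}" u v] c st by simp
  qed
  also have "\<dots> = young_const * riemann_sum young_bound D0"
    by (simp add: riemann_sum_def case_prod_unfold sum_distrib_left)
  finally show ?thesis .
qed

text \<open>\<open>young_product_small\<close> for all \<open>h\<close> at once; the variations over \<open>[a, b]\<close> bound the factor
  which is not small.\<close>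

lemma good_cell:
  assumes "0 < \<eta>"
  obtains \<epsilon> where "0 < \<epsilon>" "\<And>u v. a \<le> u \<Longrightarrow> u \<le> v \<Longrightarrow> v \<le> b \<Longrightarrow>
      (\<forall>h\<in>H. A h u v \<le> \<epsilon>) \<or> (\<forall>h\<in>H. B h u v \<le> \<epsilon>) \<Longrightarrow>
      young_bound u v \<le> \<eta> * (\<Sum>h\<in>H. A h u v + B h u v)"
proof -
  define k where "k h = rvar (1 / \<alpha> h) (R h) {a..b} + rvar (1 / \<beta> h) (Y h) {a..b}" for h
  have "\<exists>\<epsilon>>0. \<forall>x y. 0 \<le> x \<longrightarrow> x \<le> k h \<longrightarrow> 0 \<le> y \<longrightarrow> y \<le> k h \<longrightarrow> x \<le> \<epsilon> \<or> y \<le> \<epsilon> \<longrightarrow>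
      x powr \<alpha> h * y powr \<beta> h \<le> \<eta> * (x + y)" if "h \<in> H" for h
    using young_product_small[of "\<alpha> h" "\<beta> h" \<eta> "k h"] \<alpha> \<beta> \<theta> exponents assms that by metis
  then obtain \<epsilon>h where \<epsilon>h: "\<And>h. h \<in> H \<Longrightarrow> 0 < \<epsilon>h h"
    "\<And>h x y. h \<in> H \<Longrightarrow> 0 \<le> x \<Longrightarrow> x \<le> k h \<Longrightarrow> 0 \<le> y \<Longrightarrow> y \<le> k h \<Longrightarrow> x \<le> \<epsilon>h h \<or> y \<le> \<epsilon>h h \<Longrightarrow>
      x powr \<alpha> h * y powr \<beta> h \<le> \<eta> * (x + y)"
    by metis
  define \<epsilon> where "\<epsilon> = Min (insert 1 (\<epsilon>h ` H))"
  have \<epsilon>: "0 < \<epsilon>" using finite_H \<epsilon>h(1) by (auto simp: \<epsilon>_def)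
  have \<epsilon>_le: "\<epsilon> \<le> \<epsilon>h h" if "h \<in> H" for h
    unfolding \<epsilon>_def using finite_H that by (intro Min_le) auto
  show ?thesis
  proof (rule that[OF \<epsilon>])
    fix u v assume uv: "a \<le> u" "u \<le> v" "v \<le> b" "(\<forall>h\<in>H. A h u v \<le> \<epsilon>) \<or> (\<forall>h\<in>H. B h u v \<le> \<epsilon>)"
    have "young_bound u v \<le> (\<Sum>h\<in>H. \<eta> * (A h u v + B h u v))"
      unfolding young_bound_def
    proof (rule sum_mono)
      fix h assume h: "h \<in> H"
      have "A h u v \<le> rvar (1 / \<alpha> h) (R h) {a..b}" "B h u v \<le> rvar (1 / \<beta> h) (Y h) {a..b}"
        unfolding A_def B_def using uv by (intro rvar_mono R_finite Y_finite h; auto)+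
      then have "A h u v \<le> k h" "B h u v \<le> k h"
        using rvar_nonneg[of "1 / \<alpha> h" "R h" "{a..b}"] rvar_nonneg[of "1 / \<beta> h" "Y h" "{a..b}"]
        unfolding k_def by linarith+
      moreover have "A h u v \<le> \<epsilon>h h \<or> B h u v \<le> \<epsilon>h h"
        using uv(4) \<epsilon>_le[OF h] h by (meson order_trans)
      ultimately show "A h u v powr \<alpha> h * B h u v powr \<beta> h \<le> \<eta> * (A h u v + B h u v)"
        using h A_nonneg B_nonneg by (intro \<epsilon>h(2)) auto
    qed
    then show "young_bound u v \<le> \<eta> * (\<Sum>h\<in>H. A h u v + B h u v)"
      by (simp add: sum_distrib_left)
  qed
qed

lemma eventually_B_small:
  assumes "a \<le> x" "x < b" "0 < \<epsilon>"
  shows "\<forall>\<^sub>F v in at_right x. v \<le> b \<longrightarrow> (\<forall>h\<in>H. B h x v \<le> \<epsilon>)"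
proof -
  have "\<forall>\<^sub>F v in at_right x. v \<le> b \<longrightarrow> B h x v \<le> \<epsilon>" if h: "h \<in> H" for h
  proof -
    have "{x<..b} \<subseteq> {a..b}" using assms by auto
    from rvar_right_small[OF variation_finite(2)[OF h this] assms(2,3)] obtain \<delta> where
      "\<delta> > 0" "\<forall>y. x < y \<and> y < x + \<delta> \<and> y \<le> b \<longrightarrow> rvar (1 / \<beta> h) (Y h) {x<..y} \<le> \<epsilon>"
      by blast
    then show ?thesis
      unfolding eventually_at_right_field B_def by (intro exI[of _ "x + \<delta>"]) auto
  qed
  then have "\<forall>\<^sub>F v in at_right x. \<forall>h\<in>H. v \<le> b \<longrightarrow> B h x v \<le> \<epsilon>"
    by (intro eventually_ball_finite finite_H ballI)
  then show ?thesis by eventually_elim blast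
qed

lemma eventually_A_small:
  assumes "a < x" "x \<le> b" "0 < \<epsilon>"
  shows "\<forall>\<^sub>F u in at_left x. a \<le> u \<longrightarrow> (\<forall>h\<in>H. A h u x \<le> \<epsilon>)"
proof -
  have "\<forall>\<^sub>F u in at_left x. a \<le> u \<longrightarrow> A h u x \<le> \<epsilon>" if h: "h \<in> H" for h
  proof -
    have "{a..<x} \<subseteq> {a..b}" using assms by auto
    from rvar_left_small[OF variation_finite(1)[OF h this] assms(1,3)] obtain \<delta> where
      "\<delta> > 0" "\<forall>y. x - \<delta> < y \<and> y < x \<and> a \<le> y \<longrightarrow> rvar (1 / \<alpha> h) (R h) {y..<x} \<le> \<epsilon>"
      by blast
    then show ?thesis
      unfolding eventually_at_left_field A_def by (intro exI[of _ "x - \<delta>"]) auto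
  qed
  then have "\<forall>\<^sub>F u in at_left x. \<forall>h\<in>H. a \<le> u \<longrightarrow> A h u x \<le> \<epsilon>"
    by (intro eventually_ball_finite finite_H ballI)
  then show ?thesis by eventually_elim blast
qed

text \<open>By compactness it is enough to look near a point \<open>x\<close>. With \<open>x\<close> as a node, a short cell
  either ends at \<open>x\<close>, and then the left factor on \<open>[u, x)\<close> is small, or it starts at \<open>x\<close>, and then
  the right factor on \<open>(x, v]\<close> is small. Jumps of both factors at the same point do no harm: this
  is the reason for taking refinements instead of small meshes.\<close>

lemma good_partition:
  assumes "0 < \<eta>" and st: "a \<le> s" "s \<le> t" "t \<le> b"
  shows "\<exists>D\<in>partitions s t. \<forall>(u, v)\<in>cells D. young_bound u v \<le> \<eta> * (\<Sum>h\<in>H. A h u v + B h u v)"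
proof -
  define good where "good u v \<longleftrightarrow> young_bound u v \<le> \<eta> * (\<Sum>h\<in>H. A h u v + B h u v)" for u v
  \<comment> \<open>The range condition is part of \<open>P\<close> because the intervals in the local step of the bisection
    may leave \<open>[a, b]\<close>.\<close>
  define P where "P u v \<longleftrightarrow> (a \<le> u \<and> u \<le> v \<and> v \<le> b \<longrightarrow> (\<exists>D\<in>partitions u v. \<forall>(c, d)\<in>cells D. good c d))" for u v
  obtain \<epsilon> where \<epsilon>: "0 < \<epsilon>" "\<And>u v. a \<le> u \<Longrightarrow> u \<le> v \<Longrightarrow> v \<le> b \<Longrightarrow>
      (\<forall>h\<in>H. A h u v \<le> \<epsilon>) \<or> (\<forall>h\<in>H. B h u v \<le> \<epsilon>) \<Longrightarrow> good u v"
    using good_cell[OF \<open>0 < \<eta>\<close>] unfolding good_def by blast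
  have "P s t"
    using \<open>s \<le> t\<close>
  proof (induction rule: Bolzano)
    case (trans c d e)
    show ?case
      unfolding P_def
    proof
      assume ce: "a \<le> c \<and> c \<le> e \<and> e \<le> b"
      then obtain D E where DE: "D \<in> partitions c d" "\<forall>(x, y)\<in>cells D. good x y"
        "E \<in> partitions d e" "\<forall>(x, y)\<in>cells E. good x y"
        using trans unfolding P_def by (meson order_trans)
      then have "D \<union> E \<in> partitions c e" using trans by (auto simp: partitions_def)
      moreover have "\<forall>(x, y)\<in>cells (D \<union> E). good x y"
        using cells_union_adjacent[OF DE(1,3)] DE(2,4) by blast
      ultimately show "\<exists>D\<in>partitions c e. \<forall>(x, y)\<in>cells D. good x y" by blast
    qed
  next
    case (local x)
    then have x: "a \<le> x" "x \<le> b" using st by auto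
    have "\<exists>d>0. \<forall>v. x < v \<and> v < x + d \<and> v \<le> b \<longrightarrow> good x v"
    proof (cases "x < b")
      case True
      then obtain c where "c > x" "\<forall>v>x. v < c \<longrightarrow> v \<le> b \<longrightarrow> (\<forall>h\<in>H. B h x v \<le> \<epsilon>)"
        using eventually_B_small[OF x(1) True \<epsilon>(1)] unfolding eventually_at_right_field by blast
      then show ?thesis using x by (intro exI[of _ "c - x"]) (auto intro!: \<epsilon>(2))
    next
      case False
      then show ?thesis by (intro exI[of _ 1]) auto
    qed
    then obtain d1 where d1: "d1 > 0" "\<And>v. x < v \<Longrightarrow> v < x + d1 \<Longrightarrow> v \<le> b \<Longrightarrow> good x v" by blast
    have "\<exists>d>0. \<forall>u. x - d < u \<and> u < x \<and> a \<le> u \<longrightarrow> good u x"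
    proof (cases "a < x")
      case True
      then obtain c where "c < x" "\<forall>u>c. u < x \<longrightarrow> a \<le> u \<longrightarrow> (\<forall>h\<in>H. A h u x \<le> \<epsilon>)"
        using eventually_A_small[OF True x(2) \<epsilon>(1)] unfolding eventually_at_left_field by blast
      then show ?thesis using x by (intro exI[of _ "x - c"]) (auto intro!: \<epsilon>(2))
    next
      case False
      then show ?thesis by (intro exI[of _ 1]) auto
    qed
    then obtain d2 where d2: "d2 > 0" "\<And>u. x - d2 < u \<Longrightarrow> u < x \<Longrightarrow> a \<le> u \<Longrightarrow> good u x" by blast
    have "P u v" if uv: "u \<le> x" "x \<le> v" "v - u < min d1 d2" for u v
      unfolding P_def
    proof
      assume ab: "a \<le> u \<and> u \<le> v \<and> v \<le> b"
      have "{u, x, v} \<in> partitions u v" using uv by (auto simp: partitions_def)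
      moreover have "good c d" if "(c, d) \<in> cells {u, x, v}" for c d
      proof -
        have "c = u \<and> d = x \<or> c = x \<and> d = v" "c < d"
          using that uv by (auto simp: cells_def)
        then show ?thesis using d1(2)[of v] d2(2)[of u] uv ab by auto
      qed
      ultimately show "\<exists>D\<in>partitions u v. \<forall>(c, d)\<in>cells D. good c d" by blast
    qed
    then show ?case using d1(1) d2(1) by (intro exI[of _ "min d1 d2"]) auto
  qed
  then show ?thesis using st unfolding P_def good_def by blast
qed

text \<open>Over a good partition the Young bounds of the cells add up to at most \<open>\<eta>\<close> times a
  superadditive quantity, hence to at most \<open>\<eta> * L\<close>. By \<open>refinement_bound\<close> this controls every
  refinement.\<close>

theorem sewing_exists:
  assumes st: "a \<le> s" "s \<le> t" "t \<le> b"
  shows "\<exists>K. RRS_limit \<Xi> s t K"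
proof (cases "s = t")
  case True
  have "RRS_limit \<Xi> s t 0"
    unfolding RRS_limit_def using True partitions_self[of t t] by (auto simp: riemann_sum_point)
  then show ?thesis by blast
next
  case False
  then have "s < t" using st by simp
  define L where "L = (\<Sum>h\<in>H. rvar (1 / \<alpha> h) (R h) {a..b} + rvar (1 / \<beta> h) (Y h) {a..b})"
  have "L \<ge> 0" unfolding L_def by (intro sum_nonneg add_nonneg_nonneg rvar_nonneg)
  show ?thesis
  proof (rule RRS_limit_if_cauchy)
    fix \<epsilon> :: real assume "0 < \<epsilon>"
    \<comment> \<open>The summand \<open>1\<close> only keeps the denominator positive.\<close>
    define \<eta> where "\<eta> = \<epsilon> / (young_const * L + 1)"
    have pos: "0 < young_const * L + 1" using \<open>L \<ge> 0\<close> young_const_nonneg by (simp add: add_nonneg_pos)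
    then have "0 < \<eta>" using \<open>0 < \<epsilon>\<close> by (simp add: \<eta>_def)
    obtain D0 where D0: "D0 \<in> partitions s t"
      "\<And>u v. (u, v) \<in> cells D0 \<Longrightarrow> young_bound u v \<le> \<eta> * (\<Sum>h\<in>H. A h u v + B h u v)"
      using good_partition[OF \<open>0 < \<eta>\<close> st] by blast
    have "riemann_sum young_bound D0 \<le> (\<Sum>c\<in>cells D0. \<eta> * (\<Sum>h\<in>H. A h (fst c) (snd c) + B h (fst c) (snd c)))"
      unfolding riemann_sum_def case_prod_unfold using D0(2) by (intro sum_mono) auto
    also have "\<dots> = \<eta> * (\<Sum>h\<in>H. riemann_sum (A h) D0 + riemann_sum (B h) D0)"
      unfolding riemann_sum_def case_prod_unfold sum_distrib_left[symmetric]
      by (subst sum.swap) (simp add: sum.distrib)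
    also have "\<dots> \<le> \<eta> * L"
      unfolding L_def
    proof (intro mult_left_mono sum_mono add_mono)
      fix h assume h: "h \<in> H"
      have "riemann_sum (A h) D0 \<le> A h s t"
        using D0(1) \<open>s < t\<close>
      proof (rule riemann_sum_superadditive)
        fix c d e assume "s \<le> c" "c < d" "d < e" "e \<le> t"
        then show "A h c d + A h d e \<le> A h c e"
          unfolding A_def using st by (intro rvar_superadditive variation_finite h) auto
      qed
      also have "\<dots> \<le> rvar (1 / \<alpha> h) (R h) {a..b}"
        unfolding A_def using st by (intro rvar_mono R_finite h) auto
      finally show "riemann_sum (A h) D0 \<le> rvar (1 / \<alpha> h) (R h) {a..b}" .
      have "riemann_sum (B h) D0 \<le> B h s t"
        using D0(1) \<open>s < t\<close>
      proof (rule riemann_sum_superadditive)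
        fix c d e assume "s \<le> c" "c < d" "d < e" "e \<le> t"
        then show "B h c d + B h d e \<le> B h c e"
          unfolding B_def using st by (intro rvar_superadditive variation_finite h) auto
      qed
      also have "\<dots> \<le> rvar (1 / \<beta> h) (Y h) {a..b}"
        unfolding B_def using st by (intro rvar_mono Y_finite h) auto
      finally show "riemann_sum (B h) D0 \<le> rvar (1 / \<beta> h) (Y h) {a..b}" .
    qed (use \<open>0 < \<eta>\<close> in simp)
    finally have "young_const * riemann_sum young_bound D0 \<le> young_const * (\<eta> * L)"
      using young_const_nonneg by (rule mult_left_mono)
    also have "\<dots> \<le> \<eta> * (young_const * L + 1)"
      using \<open>0 < \<eta>\<close> by (simp add: algebra_simps)
    also have "\<dots> = \<epsilon>"
      using pos by (simp add: \<eta>_def)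
    finally have "young_const * riemann_sum young_bound D0 \<le> \<epsilon>" .
    then show "\<exists>D0\<in>partitions s t. \<forall>D\<in>partitions s t. D0 \<subseteq> D \<longrightarrow>
        \<bar>riemann_sum \<Xi> D - riemann_sum \<Xi> D0\<bar> \<le> \<epsilon>"
      using D0(1) refinement_bound[OF D0(1)] st by (meson order_trans)
  qed
qed

text \<open>The maximal bound passes to the limit.\<close>

theorem sewing_bound:
  assumes lim: "RRS_limit \<Xi> s t K" and st: "a \<le> s" "s \<le> t" "t \<le> b"
  shows "\<bar>K - \<Xi> s t\<bar> \<le> young_const * young_bound s t"
proof (rule field_le_epsilon)
  fix e :: real assume "0 < e"
  obtain D where D: "D \<in> partitions s t" "\<bar>riemann_sum \<Xi> D - K\<bar> < e"
    using lim[unfolded RRS_limit_def, rule_format, OF \<open>0 < e\<close>] by blast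
  have "\<bar>riemann_sum \<Xi> D - \<Xi> s t\<bar> \<le> young_const * young_bound s t"
  proof (cases "s = t")
    case True
    have "0 \<le> young_const * young_bound s t"
      using young_const_nonneg young_bound_nonneg by simp
    then show ?thesis using True D(1) st \<Xi>_self[of t] by (simp add: riemann_sum_point)
  next
    case False
    then show ?thesis using young_maximal_bound[OF D(1)] st by simp
  qed
  with D(2) show "\<bar>K - \<Xi> s t\<bar> \<le> young_const * young_bound s t + e" by linarith
qed

text \<open>Each inserted point lies in a cell \<open>(u, v)\<close> no longer than the mesh and changes the sum by
  the defect at \<open>u < x < v\<close>; the number of inserted points is fixed while the mesh tends to zero.\<close>

lemma insert_points_small:
  assumes st: "a \<le> s" "t \<le> b"
    and local_small: "\<And>x \<epsilon>. s < x \<Longrightarrow> x < t \<Longrightarrow> 0 < \<epsilon> \<Longrightarrow> \<exists>\<delta>>0. \<forall>u v. s \<le> u \<and> u < x \<and> x < v \<and> v \<le> t \<and>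
      v - u < \<delta> \<longrightarrow> \<bar>\<Sum>h\<in>H. R h u x * Y h x v\<bar> \<le> \<epsilon>"
    and E: "finite E" "E \<subseteq> {s<..<t}" and "0 < \<epsilon>"
  shows "\<exists>\<delta>>0. \<forall>D\<in>partitions s t. mesh D < \<delta> \<longrightarrow> \<bar>riemann_sum \<Xi> (D \<union> E) - riemann_sum \<Xi> D\<bar> \<le> \<epsilon>"
  using E \<open>0 < \<epsilon>\<close>
proof (induction E arbitrary: \<epsilon> rule: finite_induct)
  case empty
  then show ?case by (intro exI[of _ 1]) auto
next
  case (insert x E)
  obtain \<delta>1 where \<delta>1: "\<delta>1 > 0" "\<And>D. D \<in> partitions s t \<Longrightarrow> mesh D < \<delta>1 \<Longrightarrow>
      \<bar>riemann_sum \<Xi> (D \<union> E) - riemann_sum \<Xi> D\<bar> \<le> \<epsilon> / 2"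
    using insert.IH[of "\<epsilon> / 2"] insert.prems by auto
  have x: "s < x" "x < t" using insert.prems by auto
  from local_small[OF x, of "\<epsilon> / 2"] insert.prems obtain \<delta>2 where \<delta>2: "\<delta>2 > 0"
    "\<And>u v. s \<le> u \<Longrightarrow> u < x \<Longrightarrow> x < v \<Longrightarrow> v \<le> t \<Longrightarrow> v - u < \<delta>2 \<Longrightarrow> \<bar>\<Sum>h\<in>H. R h u x * Y h x v\<bar> \<le> \<epsilon> / 2"
    by auto
  have "\<bar>riemann_sum \<Xi> (D \<union> insert x E) - riemann_sum \<Xi> D\<bar> \<le> \<epsilon>"
    if D: "D \<in> partitions s t" "mesh D < min \<delta>1 \<delta>2" for D
  proof -
    have DE: "D \<union> E \<in> partitions s t" using D(1) insert by (auto simp: partitions_def)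
    have "\<bar>riemann_sum \<Xi> (insert x (D \<union> E)) - riemann_sum \<Xi> (D \<union> E)\<bar> \<le> \<epsilon> / 2"
    proof (cases "x \<in> D \<union> E")
      case True
      then show ?thesis using insert.prems by (simp add: insert_absorb)
    next
      case False
      obtain u v where uv: "(u, v) \<in> cells (D \<union> E)" "u < x" "x < v"
        using neighbours[OF DE x False] by blast
      have fin: "finite D" "finite (D \<union> E)" and mem: "s \<le> u" "v \<le> t" "u < v" "D \<inter> {u<..<v} = {}"
        using DE uv by (auto simp: partitions_def cells_def Int_Un_distrib2)
      obtain u' v' where uv': "(u', v') \<in> cells D" "u' \<le> u" "v \<le> v'"
        using cell_covering[OF D(1) mem(1,3,2,4)] by blast
      have "v - u < \<delta>2" using cell_le_mesh[OF fin(1) uv'(1)] uv' D(2) by simp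
      moreover have "riemann_sum \<Xi> (insert x (D \<union> E))
          = riemann_sum \<Xi> (D \<union> E) - \<Xi> u v + \<Xi> u x + \<Xi> x v"
        by (rule riemann_sum_insert[OF fin(2) uv])
      moreover have "\<Xi> u v = \<Xi> u x + \<Xi> x v - (\<Sum>h\<in>H. R h u x * Y h x v)"
        using mem st uv by (intro defect) auto
      ultimately show ?thesis using \<delta>2(2)[OF mem(1) uv(2,3) mem(2)] by simp
    qed
    moreover have "\<bar>riemann_sum \<Xi> (D \<union> E) - riemann_sum \<Xi> D\<bar> \<le> \<epsilon> / 2"
      using \<delta>1(2) D by simp
    ultimately show ?thesis unfolding Un_insert_right by linarith
  qed
  then show ?case using \<delta>1(1) \<delta>2(1) by (intro exI[of _ "min \<delta>1 \<delta>2"]) auto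
qed

text \<open>A partition \<open>D\<close> of small mesh is compared with its union with one partition \<open>D0\<close> that is
  good for the limit under refinement. Only the finitely many nodes of \<open>D0\<close> matter, so it is
  enough that the defect at each fixed point becomes small.\<close>

theorem MRS_limit_if_RRS_limit:
  assumes lim: "RRS_limit \<Xi> s t K" and st: "a \<le> s" "t \<le> b"
    and local_small: "\<And>x \<epsilon>. s < x \<Longrightarrow> x < t \<Longrightarrow> 0 < \<epsilon> \<Longrightarrow> \<exists>\<delta>>0. \<forall>u v. s \<le> u \<and> u < x \<and> x < v \<and> v \<le> t \<and>
      v - u < \<delta> \<longrightarrow> \<bar>\<Sum>h\<in>H. R h u x * Y h x v\<bar> \<le> \<epsilon>"
  shows "MRS_limit \<Xi> s t K"
  unfolding MRS_limit_def
proof (intro allI impI)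
  fix \<epsilon> :: real assume "0 < \<epsilon>"
  then have "0 < \<epsilon> / 2" by simp
  obtain D0 where D0: "D0 \<in> partitions s t"
    "\<And>D. D \<in> partitions s t \<Longrightarrow> D0 \<subseteq> D \<Longrightarrow> \<bar>riemann_sum \<Xi> D - K\<bar> < \<epsilon> / 2"
    using lim[unfolded RRS_limit_def, rule_format, OF \<open>0 < \<epsilon> / 2\<close>] by blast
  have E: "finite (D0 - {s, t})" "D0 - {s, t} \<subseteq> {s<..<t}"
    using D0(1) by (force simp: partitions_def)+
  obtain \<delta> where \<delta>: "\<delta> > 0" "\<And>D. D \<in> partitions s t \<Longrightarrow> mesh D < \<delta> \<Longrightarrow>
      \<bar>riemann_sum \<Xi> (D \<union> (D0 - {s, t})) - riemann_sum \<Xi> D\<bar> \<le> \<epsilon> / 2"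
    using insert_points_small[OF st local_small E \<open>0 < \<epsilon> / 2\<close>] by blast
  have "\<bar>riemann_sum \<Xi> D - K\<bar> < \<epsilon>" if D: "D \<in> partitions s t" "mesh D < \<delta>" for D
  proof -
    have "D \<union> (D0 - {s, t}) = D \<union> D0" using D(1) by (auto simp: partitions_def)
    then have "\<bar>riemann_sum \<Xi> (D \<union> D0) - riemann_sum \<Xi> D\<bar> \<le> \<epsilon> / 2" using \<delta>(2)[OF D] by simp
    moreover have "\<bar>riemann_sum \<Xi> (D \<union> D0) - K\<bar> < \<epsilon> / 2"
      using D0(2)[OF union_partition[OF D(1) D0(1)]] by simp
    ultimately show ?thesis by (simp add: abs_if split: if_splits)
  qed
  then show "\<exists>\<delta>>0. \<forall>D\<in>partitions s t. mesh D < \<delta> \<longrightarrow> \<bar>riemann_sum \<Xi> D - K\<bar> < \<epsilon>"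
    using \<delta>(1) by blast
qed

lemma R_bounded:
  assumes "h \<in> H" "a \<le> u" "u < x" "x \<le> b"
  shows "\<bar>R h u x\<bar> \<le> rvar (1 / \<alpha> h) (R h) {u..x} powr \<alpha> h"
  using assms by (intro abs_le_powr_of_powr_inverse_le abs_powr_le_rvar variation_finite \<alpha>) auto

lemma Y_bounded:
  assumes "h \<in> H" "a \<le> x" "x < v" "v \<le> b"
  shows "\<bar>Y h x v\<bar> \<le> rvar (1 / \<beta> h) (Y h) {x..v} powr \<beta> h"
  using assms by (intro abs_le_powr_of_powr_inverse_le abs_powr_le_rvar variation_finite \<beta>) auto

text \<open>The right factor tends to zero and the left factor is bounded.\<close>

lemma local_small_if_Y_vanishes:
  assumes x: "a \<le> s" "s < x" "x < t" "t \<le> b" and "0 < \<epsilon>"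
    and van: "\<And>h. h \<in> H \<Longrightarrow> (Y h x \<longlongrightarrow> 0) (at_right x)"
  shows "\<exists>\<delta>>0. \<forall>u v. s \<le> u \<and> u < x \<and> x < v \<and> v \<le> t \<and> v - u < \<delta> \<longrightarrow> \<bar>\<Sum>h\<in>H. R h u x * Y h x v\<bar> \<le> \<epsilon>"
proof -
  define c where "c h = rvar (1 / \<alpha> h) (R h) {a..b} powr \<alpha> h" for h
  have "((\<lambda>v. \<Sum>h\<in>H. c h * \<bar>Y h x v\<bar>) \<longlongrightarrow> (\<Sum>h\<in>H. c h * \<bar>0\<bar>)) (at_right x)"
    using van by (intro tendsto_intros) auto
  then have "\<forall>\<^sub>F v in at_right x. (\<Sum>h\<in>H. c h * \<bar>Y h x v\<bar>) < \<epsilon>"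
    using \<open>0 < \<epsilon>\<close> by (intro order_tendstoD(2)) auto
  then obtain y where y: "x < y" "\<And>v. x < v \<Longrightarrow> v < y \<Longrightarrow> (\<Sum>h\<in>H. c h * \<bar>Y h x v\<bar>) < \<epsilon>"
    unfolding eventually_at_right_field by blast
  have "\<bar>\<Sum>h\<in>H. R h u x * Y h x v\<bar> \<le> \<epsilon>" if "s \<le> u" "u < x" "x < v" "v \<le> t" "v - u < y - x" for u v
  proof -
    have "\<bar>R h u x\<bar> \<le> c h" if "h \<in> H" for h
    proof -
      have "rvar (1 / \<alpha> h) (R h) {u..x} powr \<alpha> h \<le> c h"
        unfolding c_def using that \<alpha>[OF that] x \<open>s \<le> u\<close>
        by (intro powr_mono2 rvar_mono R_finite rvar_nonneg) auto
      then show ?thesis using R_bounded[OF that, of u x] x \<open>s \<le> u\<close> \<open>u < x\<close> by linarith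
    qed
    then have "\<bar>\<Sum>h\<in>H. R h u x * Y h x v\<bar> \<le> (\<Sum>h\<in>H. c h * \<bar>Y h x v\<bar>)"
      by (intro order_trans[OF sum_abs] sum_mono) (simp add: abs_mult mult_right_mono)
    also have "\<dots> < \<epsilon>" using that by (intro y) auto
    finally show ?thesis by simp
  qed
  then show ?thesis using y(1) by (intro exI[of _ "y - x"]) auto
qed

text \<open>The left factor tends to zero and the right factor is bounded.\<close>

lemma local_small_if_R_vanishes:
  assumes x: "a \<le> s" "s < x" "x < t" "t \<le> b" and "0 < \<epsilon>"
    and van: "\<And>h. h \<in> H \<Longrightarrow> ((\<lambda>u. R h u x) \<longlongrightarrow> 0) (at_left x)"
  shows "\<exists>\<delta>>0. \<forall>u v. s \<le> u \<and> u < x \<and> x < v \<and> v \<le> t \<and> v - u < \<delta> \<longrightarrow> \<bar>\<Sum>h\<in>H. R h u x * Y h x v\<bar> \<le> \<epsilon>"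
proof -
  define c where "c h = rvar (1 / \<beta> h) (Y h) {a..b} powr \<beta> h" for h
  have "((\<lambda>u. \<Sum>h\<in>H. \<bar>R h u x\<bar> * c h) \<longlongrightarrow> (\<Sum>h\<in>H. \<bar>0\<bar> * c h)) (at_left x)"
    using van by (intro tendsto_intros) auto
  then have "\<forall>\<^sub>F u in at_left x. (\<Sum>h\<in>H. \<bar>R h u x\<bar> * c h) < \<epsilon>"
    using \<open>0 < \<epsilon>\<close> by (intro order_tendstoD(2)) auto
  then obtain y where y: "y < x" "\<And>u. y < u \<Longrightarrow> u < x \<Longrightarrow> (\<Sum>h\<in>H. \<bar>R h u x\<bar> * c h) < \<epsilon>"
    unfolding eventually_at_left_field by blast
  have "\<bar>\<Sum>h\<in>H. R h u x * Y h x v\<bar> \<le> \<epsilon>" if "s \<le> u" "u < x" "x < v" "v \<le> t" "v - u < x - y" for u v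
  proof -
    have "\<bar>Y h x v\<bar> \<le> c h" if "h \<in> H" for h
    proof -
      have "rvar (1 / \<beta> h) (Y h) {x..v} powr \<beta> h \<le> c h"
        unfolding c_def using that \<beta>[OF that] x \<open>v \<le> t\<close>
        by (intro powr_mono2 rvar_mono Y_finite rvar_nonneg) auto
      then show ?thesis using Y_bounded[OF that, of x v] x \<open>x < v\<close> \<open>v \<le> t\<close> by linarith
    qed
    then have "\<bar>\<Sum>h\<in>H. R h u x * Y h x v\<bar> \<le> (\<Sum>h\<in>H. \<bar>R h u x\<bar> * c h)"
      by (intro order_trans[OF sum_abs] sum_mono) (simp add: abs_mult mult_left_mono)
    also have "\<dots> < \<epsilon>" using that by (intro y) auto
    finally show ?thesis by simp
  qed
  then show ?thesis using y(1) by (intro exI[of _ "x - y"]) auto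
qed

end

section \<open>The rough integral\<close>

lemma ennpowr_finite_iff: "ennpowr x c < \<infinity> \<longleftrightarrow> x < \<infinity>"
  by (auto simp: ennpowr_def less_top[symmetric])

lemma pvar_finite:
  "power_variation q F I < \<infinity> \<Longrightarrow> pvar q F I = ennreal (rvar q F I powr (1 / q))"
  by (simp add: pvar_eq ennpowr_def rvar_def)

lemma ennpowr_pvar:
  assumes "0 < q"
  shows "ennpowr (pvar q F I) q = power_variation q F I"
proof (cases "power_variation q F I < \<infinity>")
  case True
  then have "ennpowr (pvar q F I) q = ennreal (rvar q F I)"
    using assms rvar_nonneg[of q F I] by (simp add: pvar_finite ennpowr_def powr_powr)
  also have "\<dots> = power_variation q F I"
    using True by (simp add: rvar_def)
  finally show ?thesis .
qed (simp add: pvar_eq ennpowr_def less_top[symmetric])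

lemma member_le_sum_ennreal:
  fixes f :: "'x \<Rightarrow> ennreal"
  assumes "finite A" "x \<in> A"
  shows "f x \<le> sum f A"
  using sum_mono2[of A "{x}" f] assms by simp

lemma tendsto_0_if_le_powr:
  fixes f g :: "real \<Rightarrow> real"
  assumes "(g \<longlongrightarrow> 0) F" "\<forall>\<^sub>F x in F. 0 \<le> g x \<and> \<bar>f x\<bar> \<le> g x powr c" "0 < c"
  shows "(f \<longlongrightarrow> 0) F"
proof (rule Lim_null_comparison)
  show "\<forall>\<^sub>F x in F. norm (f x) \<le> g x powr c"
    using assms(2) by eventually_elim simp
  have "\<forall>\<^sub>F x in F. 0 \<le> g x" using assms(2) by eventually_elim simp
  then show "((\<lambda>x. g x powr c) \<longlongrightarrow> 0) F"
    using assms by (intro tendsto_zero_powrI[where b = c]) auto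
qed

text \<open>The data of the theorem. They form a Young germ with \<open>\<theta> = (\<gamma> + 1) / p\<close>, which exceeds \<open>1\<close>
  because \<open>\<gamma> + 1 \<ge> \<lfloor>p\<rfloor> + 1 > p\<close>.\<close>

locale rough_integrand =
  fixes p \<gamma> T :: real and X :: "real \<Rightarrow> 'd::finite ck_dual" and Z :: "real \<Rightarrow> 'd ck"
    and \<omega> :: "real \<Rightarrow> real \<Rightarrow> real" and i :: 'd
  assumes p: "1 \<le> p" and \<gamma>: "real (level p) \<le> \<gamma>" and T: "0 \<le> T"
    and X: "branched_rough_path p T X" and Z: "controlled_rough_path p \<gamma> T X Z \<omega>"
begin

abbreviation F where "F \<equiv> forests0 (level p - 1) :: 'd forest set"
abbreviation R where "R \<equiv> remainder p X Z"
abbreviation Y where "Y \<equiv> (\<lambda>h u v. increment p X u v (graft i h))"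
abbreviation \<alpha> where "\<alpha> \<equiv> (\<lambda>h::'d forest. (\<gamma> - forest_size h) / p)"
abbreviation \<beta> where "\<beta> \<equiv> (\<lambda>h::'d forest. (forest_size h + 1) / p)"

lemma level_bounds: "1 \<le> level p" "p < level p + 1"
  using p by (auto simp: level_def le_nat_iff) linarith

lemma \<alpha>_pos: "h \<in> F \<Longrightarrow> 0 < \<alpha> h"
  using p \<gamma> level_bounds by (auto simp: forests0_def)

lemma \<beta>_pos: "0 < \<beta> h"
  using p by simp

lemma X_carrier: "\<forall>t\<in>{0..T}. X t \<in> carrier (butcher_group (level p))"
  using X by (simp add: branched_rough_path_def)

lemma graft_forests: "h \<in> F \<Longrightarrow> graft i h \<in> forests (level p)"
  using level_bounds by (auto simp: forests_def forests0_def)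

lemma forests_size_pos: "f \<in> forests (level p) \<Longrightarrow> 0 < forest_size f"
  using size_le_forest_size[of f] by (auto simp: forests_def nonempty_has_size)

lemma R_variation_le:
  assumes "h \<in> F" "0 \<le> s" "s \<le> t" "t \<le> T"
  shows "power_variation (1 / \<alpha> h) (R h) {s..t} \<le> ennreal (\<omega> s t)"
proof -
  have "power_variation (1 / \<alpha> h) (R h) {s..t}
      = ennpowr (pvar (p / (\<gamma> - forest_size h)) (R h) {s..t}) (p / (\<gamma> - forest_size h))"
    using \<alpha>_pos[OF assms(1)] p by (subst ennpowr_pvar) (auto simp: zero_less_divide_iff)
  also have "\<dots> \<le> (\<Sum>f\<in>F. ennpowr (pvar (p / (\<gamma> - forest_size f)) (R f) {s..t}) (p / (\<gamma> - forest_size f)))"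
    by (rule member_le_sum_ennreal[OF finite_forests0 assms(1)])
  also have "\<dots> \<le> ennreal (\<omega> s t)"
    using Z assms by (simp add: controlled_rough_path_def)
  finally show ?thesis .
qed

lemma R_finite:
  assumes "h \<in> F"
  shows "power_variation (1 / \<alpha> h) (R h) {0..T} < \<infinity>"
  using R_variation_le[OF assms, of 0 T] T by (auto intro: le_less_trans)

lemma X_finite:
  assumes "f \<in> forests (level p)"
  shows "power_variation (p / forest_size f) (\<lambda>u v. increment p X u v f) {0..T} < \<infinity>"
proof -
  have "pvar (p / forest_size f) (\<lambda>u v. increment p X u v f) {0..T} < \<infinity>"
    using X assms unfolding branched_rough_path_def by blast
  then show ?thesis unfolding pvar_eq ennpowr_finite_iff .
qed

lemma Y_exponent: "1 / \<beta> h = p / forest_size (graft i h)"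
  by (simp add: add.commute)

sublocale young_germ 0 T "(\<gamma> + 1) / p" F R Y \<alpha> \<beta> "germ p X Z i"
proof
  show "finite F" by (rule finite_forests0)
  show "1 < (\<gamma> + 1) / p" using p \<gamma> level_bounds by simp
  fix h :: "'d forest" assume h: "h \<in> F"
  show "0 < \<alpha> h" by (rule \<alpha>_pos[OF h])
  show "0 < \<beta> h" by (rule \<beta>_pos)
  show "\<alpha> h + \<beta> h = (\<gamma> + 1) / p" by (simp flip: add_divide_distrib)
  show "power_variation (1 / \<alpha> h) (R h) {0..T} < \<infinity>" by (rule R_finite[OF h])
  show "power_variation (1 / \<beta> h) (Y h) {0..T} < \<infinity>"
    unfolding Y_exponent by (rule X_finite[OF graft_forests[OF h]])
next
  fix s :: real assume "0 \<le> s" "s \<le> T"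
  then show "germ p X Z i s s = 0" using X_carrier by (intro germ_self) auto
next
  fix s u t :: real assume "0 \<le> s" "s \<le> u" "u \<le> t" "t \<le> T"
  then show "germ p X Z i s t = germ p X Z i s u + germ p X Z i u t - (\<Sum>h\<in>F. R h s u * Y h u t)"
    by (intro germ_chen[OF X_carrier _ _ _ p]) auto
qed

lemma rough_integral_limit:
  assumes "0 \<le> s" "s \<le> t" "t \<le> T"
  shows "RRS_limit (germ p X Z i) s t (rough_integral p X Z i s t)"
  unfolding rough_integral_def
  by (rule theI', rule ex_ex1I[OF sewing_exists[OF assms] RRS_limit_unique])

lemma young_bound_eq:
  assumes "0 \<le> s" "t \<le> T"
  shows "ennreal (young_bound s t) = (\<Sum>h\<in>F. pvar (p / (\<gamma> - forest_size h)) (R h) {s..<t}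
      * pvar (p / (forest_size h + 1)) (Y h) {s<..t})"
  unfolding young_bound_def
proof (subst sum_ennreal[symmetric], simp, rule sum.cong[OF refl])
  fix h assume h: "h \<in> F"
  have sub: "{s..<t} \<subseteq> {0..T}" "{s<..t} \<subseteq> {0..T}" using assms by auto
  have "pvar (p / (\<gamma> - forest_size h)) (R h) {s..<t} = ennreal (A h s t powr \<alpha> h)"
    using pvar_finite[OF variation_finite(1)[OF h sub(1)]] unfolding A_def by simp
  moreover have "pvar (p / (forest_size h + 1)) (Y h) {s<..t} = ennreal (B h s t powr \<beta> h)"
    using pvar_finite[OF variation_finite(2)[OF h sub(2)]] unfolding B_def by simp
  ultimately show "ennreal (A h s t powr \<alpha> h * B h s t powr \<beta> h) =
      pvar (p / (\<gamma> - forest_size h)) (R h) {s..<t} * pvar (p / (forest_size h + 1)) (Y h) {s<..t}"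
    by (simp only:) (rule ennreal_mult, simp_all)
qed

lemma rough_integral_bound:
  assumes "0 \<le> s" "s \<le> t" "t \<le> T"
  shows "ennreal \<bar>rough_integral p X Z i s t - germ p X Z i s t\<bar> \<le> ennreal young_const *
    (\<Sum>h\<in>F. pvar (p / (\<gamma> - forest_size h)) (R h) {s..<t}
      * pvar (p / (forest_size h + 1)) (Y h) {s<..t})"
  unfolding young_bound_eq[OF assms(1,3), symmetric] ennreal_mult[OF young_const_nonneg young_bound_nonneg, symmetric]
  by (intro ennreal_leI sewing_bound rough_integral_limit assms)

lemma rough_control_eq:
  "rough_control p X s t =
    (\<Sum>f\<in>forests (level p). power_variation (p / forest_size f) (\<lambda>u v. increment p X u v f) {s..t})"
  unfolding rough_control_def
  by (intro sum.cong refl ennpowr_pvar divide_pos_pos) (use p forests_size_pos in auto)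

lemma finite_forests: "finite (forests (level p) :: 'd forest set)"
  by (simp add: forests_def finite_forests0)

lemma rough_control_finite:
  assumes "0 \<le> s" "t \<le> T"
  shows "rough_control p X s t < \<infinity>"
proof -
  have "power_variation (p / forest_size f) (\<lambda>u v. increment p X u v f) {s..t} < \<infinity>"
    if "f \<in> forests (level p)" for f
    by (rule power_variation_finite_mono[OF X_finite[OF that]]) (use assms in auto)
  then show ?thesis
    unfolding rough_control_eq using finite_forests by (force simp: less_top[symmetric])
qed

lemma rough_control_superadditive:
  assumes "0 \<le> s" "s \<le> u" "u \<le> t" "t \<le> T"
  shows "enn2real (rough_control p X s u) + enn2real (rough_control p X u t) \<le> enn2real (rough_control p X s t)"
proof -
  have "rough_control p X s u + rough_control p X u t \<le> rough_control p X s t"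
    unfolding rough_control_eq sum.distrib[symmetric]
    using assms by (intro sum_mono power_variation_superadditive) auto
  then show ?thesis
    using rough_control_finite[of s u] rough_control_finite[of u t] rough_control_finite[of s t] assms
    by (simp add: enn2real_mono flip: enn2real_plus)
qed

text \<open>By superadditivity the control of \<open>[x, v]\<close> is at most that of \<open>[x, t]\<close> minus that of
  \<open>[v, t]\<close>, which tends to zero as \<open>v \<down> x\<close>: the rough path has no jump to the right of \<open>x\<close>.\<close>

lemma Y_vanishes_if_right_continuous:
  assumes h: "h \<in> F" and x: "0 \<le> x" "x < t" "t \<le> T"
    and lim: "((\<lambda>u. rough_control p X u t) \<longlongrightarrow> rough_control p X x t) (at_right x)"
  shows "(Y h x \<longlongrightarrow> 0) (at_right x)"
proof -
  let ?w = "\<lambda>u v. enn2real (rough_control p X u v)"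
  have "((\<lambda>u. rough_control p X u t) \<longlongrightarrow> ennreal (?w x t)) (at_right x)"
    using lim rough_control_finite[of x t] x by simp
  then have "((\<lambda>u. ?w u t) \<longlongrightarrow> ?w x t) (at_right x)"
    by (rule tendsto_enn2real) simp
  then have lim': "((\<lambda>v. ?w x t - ?w v t) \<longlongrightarrow> ?w x t - ?w x t) (at_right x)"
    by (intro tendsto_diff tendsto_const)
  have "\<forall>\<^sub>F v in at_right x. x < v \<and> v < t"
    using \<open>x < t\<close> unfolding eventually_at_right_field by blast
  then have ev: "\<forall>\<^sub>F v in at_right x. 0 \<le> ?w x t - ?w v t \<and> \<bar>Y h x v\<bar> \<le> (?w x t - ?w v t) powr \<beta> h"
  proof eventually_elim
    case (elim v)
    then have v: "x < v" "v < t" by auto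
    have "rvar (1 / \<beta> h) (Y h) {x..v} \<le> ?w x v"
      unfolding rvar_def
    proof (rule enn2real_mono)
      show "power_variation (1 / \<beta> h) (Y h) {x..v} \<le> rough_control p X x v"
        unfolding rough_control_eq Y_exponent
        by (rule member_le_sum_ennreal[OF finite_forests graft_forests[OF h]])
      show "rough_control p X x v < top_class.top" using rough_control_finite[of x v] v x by simp
    qed
    moreover have "?w x v + ?w v t \<le> ?w x t"
      using v x by (intro rough_control_superadditive) auto
    ultimately have le: "rvar (1 / \<beta> h) (Y h) {x..v} \<le> ?w x t - ?w v t" by linarith
    then have "rvar (1 / \<beta> h) (Y h) {x..v} powr \<beta> h \<le> (?w x t - ?w v t) powr \<beta> h"
      using \<beta>_pos[of h] by (intro powr_mono2 rvar_nonneg) auto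
    then show ?case
      using Y_bounded[OF h, of x v] v x le rvar_nonneg[of "1 / \<beta> h" "Y h" "{x..v}"] by linarith
  qed
  show ?thesis
    by (rule tendsto_0_if_le_powr[OF _ ev \<beta>_pos]) (use lim' in simp)
qed

text \<open>In the same way, \<open>\<omega> u x \<le> \<omega> 0 x - \<omega> 0 u\<close> tends to zero as \<open>u \<up> x\<close>: the remainders have no
  jump to the left of \<open>x\<close>.\<close>

lemma R_vanishes_if_left_continuous:
  assumes h: "h \<in> F" and x: "0 < x" "x \<le> T"
    and lim: "((\<lambda>u. \<omega> 0 u) \<longlongrightarrow> \<omega> 0 x) (at_left x)"
  shows "((\<lambda>u. R h u x) \<longlongrightarrow> 0) (at_left x)"
proof -
  have control: "is_control T \<omega>" using Z by (simp add: controlled_rough_path_def)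
  have lim': "((\<lambda>u. \<omega> 0 x - \<omega> 0 u) \<longlongrightarrow> \<omega> 0 x - \<omega> 0 x) (at_left x)"
    using lim by (intro tendsto_intros)
  have "\<forall>\<^sub>F u in at_left x. 0 < u \<and> u < x"
    using \<open>0 < x\<close> unfolding eventually_at_left_field by blast
  then have ev: "\<forall>\<^sub>F u in at_left x. 0 \<le> \<omega> 0 x - \<omega> 0 u \<and> \<bar>R h u x\<bar> \<le> (\<omega> 0 x - \<omega> 0 u) powr \<alpha> h"
  proof eventually_elim
    case (elim u)
    then have u: "0 < u" "u < x" by auto
    have nonneg: "0 \<le> \<omega> u x"
      using control u x unfolding is_control_def by simp
    have "rvar (1 / \<alpha> h) (R h) {u..x} \<le> enn2real (ennreal (\<omega> u x))"
      unfolding rvar_def using R_variation_le[OF h, of u x] u x by (intro enn2real_mono) auto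
    also have "\<dots> = \<omega> u x" using nonneg by simp
    also have "\<dots> \<le> \<omega> 0 x - \<omega> 0 u"
    proof -
      have "\<omega> 0 u + \<omega> u x \<le> \<omega> 0 x"
        using control u x unfolding is_control_def by auto
      then show ?thesis by simp
    qed
    finally have le: "rvar (1 / \<alpha> h) (R h) {u..x} \<le> \<omega> 0 x - \<omega> 0 u" .
    then have "rvar (1 / \<alpha> h) (R h) {u..x} powr \<alpha> h \<le> (\<omega> 0 x - \<omega> 0 u) powr \<alpha> h"
      using \<alpha>_pos[OF h] by (intro powr_mono2 rvar_nonneg) auto
    then show ?case
      using R_bounded[OF h, of u x] u x le rvar_nonneg[of "1 / \<alpha> h" "R h" "{u..x}"] by linarith
  qed
  show ?thesis
    by (rule tendsto_0_if_le_powr[OF _ ev \<alpha>_pos[OF h]]) (use lim' in simp)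
qed

lemma rough_integral_MRS_limit:
  assumes cont: "(\<forall>s t. 0 \<le> s \<and> s < t \<and> t \<le> T \<longrightarrow>
        ((\<lambda>u. rough_control p X u t) \<longlongrightarrow> rough_control p X s t) (at_right s)) \<or>
      (\<forall>s t. 0 \<le> s \<and> s < t \<and> t \<le> T \<longrightarrow> ((\<lambda>u. \<omega> s u) \<longlongrightarrow> \<omega> s t) (at_left t))"
    and st: "0 \<le> s" "s \<le> t" "t \<le> T"
  shows "MRS_limit (germ p X Z i) s t (rough_integral p X Z i s t)"
proof (rule MRS_limit_if_RRS_limit[OF rough_integral_limit[OF st] st(1,3)])
  fix x \<epsilon> :: real assume x: "s < x" "x < t" and "0 < \<epsilon>"
  from cont show "\<exists>\<delta>>0. \<forall>u v. s \<le> u \<and> u < x \<and> x < v \<and> v \<le> t \<and> v - u < \<delta> \<longrightarrow>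
      \<bar>\<Sum>h\<in>F. R h u x * Y h x v\<bar> \<le> \<epsilon>"
  proof
    assume right: "\<forall>s t. 0 \<le> s \<and> s < t \<and> t \<le> T \<longrightarrow>
        ((\<lambda>u. rough_control p X u t) \<longlongrightarrow> rough_control p X s t) (at_right s)"
    have "(Y h x \<longlongrightarrow> 0) (at_right x)" if "h \<in> F" for h
      by (rule Y_vanishes_if_right_continuous[OF that, of x t]) (use right x st in auto)
    then show ?thesis
      using local_small_if_Y_vanishes[OF st(1) x st(3) \<open>0 < \<epsilon>\<close>] by blast
  next
    assume left: "\<forall>s t. 0 \<le> s \<and> s < t \<and> t \<le> T \<longrightarrow> ((\<lambda>u. \<omega> s u) \<longlongrightarrow> \<omega> s t) (at_left t)"
    have "((\<lambda>u. R h u x) \<longlongrightarrow> 0) (at_left x)" if "h \<in> F" for h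
      by (rule R_vanishes_if_left_continuous[OF that]) (use left x st in auto)
    then show ?thesis
      using local_small_if_R_vanishes[OF st(1) x st(3) \<open>0 < \<epsilon>\<close>] by blast
  qed
qed

end

theorem theorem4p13:
  fixes p \<gamma> :: real
  assumes "1 \<le> p" and "real (level p) \<le> \<gamma>"
  shows "\<exists>C::real. \<forall>(T::real) (X :: real \<Rightarrow> ('d::finite) ck_dual) (Z :: real \<Rightarrow> 'd ck)
      (\<omega> :: real \<Rightarrow> real \<Rightarrow> real) (i::'d).
    0 \<le> T \<and> branched_rough_path p T X \<and> controlled_rough_path p \<gamma> T X Z \<omega> \<longrightarrow>
      (\<forall>s t. 0 \<le> s \<and> s \<le> t \<and> t \<le> T \<longrightarrow>
         RRS_limit (germ p X Z i) s t (rough_integral p X Z i s t) \<and>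
         ennreal \<bar>rough_integral p X Z i s t - germ p X Z i s t\<bar>
           \<le> ennreal C * (\<Sum>h\<in>forests0 (level p - 1).
                pvar (p / (\<gamma> - forest_size h)) (remainder p X Z h) {s..<t}
                  * pvar (p / (forest_size h + 1)) (\<lambda>u v. increment p X u v (graft i h)) {s<..t})) \<and>
      ((\<forall>s t. 0 \<le> s \<and> s < t \<and> t \<le> T \<longrightarrow>
           ((\<lambda>u. rough_control p X u t) \<longlongrightarrow> rough_control p X s t) (at_right s)) \<or>
       (\<forall>s t. 0 \<le> s \<and> s < t \<and> t \<le> T \<longrightarrow>
           ((\<lambda>u. \<omega> s u) \<longlongrightarrow> \<omega> s t) (at_left t)) \<longrightarrow>
         (\<forall>s t. 0 \<le> s \<and> s \<le> t \<and> t \<le> T \<longrightarrow>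
           MRS_limit (germ p X Z i) s t (rough_integral p X Z i s t)))"
proof (rule exI[of _ "(2 * card (forests0 (level p - 1) :: 'd forest set)) powr ((\<gamma> + 1) / p)
    * suminf (\<lambda>k. real (Suc k) powr - ((\<gamma> + 1) / p))"], intro allI impI, goal_cases)
  \<comment> \<open>The constant is \<open>young_const\<close>, which has to be named before the locale can be entered.\<close>
  case (1 T X Z \<omega> i)
  then interpret rough_integrand p \<gamma> T X Z \<omega> i
    using assms by unfold_locales auto
  note bound = rough_integral_bound[unfolded young_const_def]
  show ?case
    by (intro conjI allI impI; elim conjE)
      (rule rough_integral_limit bound rough_integral_MRS_limit; assumption)+
qed

end
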